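(* Let $\lambda>0$ and $\rho>0$ be fixed. As $\gamma\to0+$ the following limits hold: for each choice of the sign, $$\varphi_{\rho,+}^{x_{1\pm},x_{2\pm}}\longrightarrow\sqrt{\frac\lambda2}\,\frac\rho2\,\operatorname{sech}\Big(\frac{\lambda\rho}4\Big(\,\cdot\,\mp\frac2{\lambda\rho}\log(3+2\sqrt2)\Big)\Big)\quad\text{in the strong topology of }Q_{\delta'},$$ and $$\varphi_{\rho,-}^{\bar x,-\bar x}\longrightarrow0\quad\text{in the sense of distributions}.$$
   Context: $Q_{\delta'}=H^1(\mathbb R^+)\oplus H^1(\mathbb R^-)$ with its natural Hilbert norm. For $\lambda,\gamma,\omega>0$ define the following functions (stationary states of the focusing cubic NLS with nonlinearity coefficient $\lambda$ and a delta prime interaction of strength $\gamma$). (i) For $\omega>0$, $\psi_{\omega,+}^{x_{1\pm},x_{2\pm}}(x)=\sqrt{2\omega/\lambda}\,\operatorname{sech}(\sqrt\omega(x-x_{1\pm}))$ for $x<0$ and $\sqrt{2\omega/\lambda}\,\operatorname{sech}(\sqrt\omega(x-x_{2\pm}))$ for $x>0$, where $x_{i+}=\frac1{2\sqrt\omega}\log\frac{1+t_i}{1-t_i}$ ($i=1,2$), $x_{1-}=-x_{2+}$, $x_{2-}=-x_{1+}$, and $$t_1=\frac{1-\sqrt{1+\gamma^2\omega}+\sqrt{\gamma^2\omega-2+2\sqrt{1+\gamma^2\omega}}}{2\gamma\sqrt\omega},\quad t_2=\frac{-1+\sqrt{1+\gamma^2\omega}+\sqrt{\gamma^2\omega-2+2\sqrt{1+\gamma^2\omega}}}{2\gamma\sqrt\omega}.$$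 (ii) For $\omega>4/\gamma^2$, $\psi_{\omega,-}^{\bar x,-\bar x}(x)=-\sqrt{2\omega/\lambda}\,\operatorname{sech}(\sqrt\omega(x-\bar x))$ for $x<0$ and $\sqrt{2\omega/\lambda}\,\operatorname{sech}(\sqrt\omega(x+\bar x))$ for $x>0$, with $\bar x=\frac1{2\sqrt\omega}\log\frac{\gamma\sqrt\omega+2}{\gamma\sqrt\omega-2}$. In each family the squared $L^2$-norm is a strictly increasing function of $\omega$ with range $(0,+\infty)$; for $\rho>0$, $\varphi_{\rho,+}^{x_{1\pm},x_{2\pm}}$ and $\varphi_{\rho,-}^{\bar x,-\bar x}$ denote the member of the corresponding family ($\gamma,\lambda$ given) whose squared $L^2$-norm equals $\rho$. *)

theory Defs
  imports "HOL-Analysis.Analysis"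
begin

section \<open>Lebesgue and Sobolev spaces on open subsets of the line\<close>

definition L2 :: "real set \<Rightarrow> (real \<Rightarrow> complex) set" where
  "L2 S = {f. f \<in> borel_measurable (lebesgue_on S) \<and>
              integrable (lebesgue_on S) (\<lambda>x. (cmod (f x))\<^sup>2)}"

definition L2_norm_sq :: "real set \<Rightarrow> (real \<Rightarrow> complex) \<Rightarrow> real" where
  "L2_norm_sq S f = (\<integral>x. (cmod (f x))\<^sup>2 \<partial>(lebesgue_on S))"

definition test_function :: "real set \<Rightarrow> (real \<Rightarrow> complex) \<Rightarrow> bool" where
  "test_function S \<phi> \<longleftrightarrow>
     (\<exists>D :: nat \<Rightarrow> real \<Rightarrow> complex. D 0 = \<phi> \<and>
        (\<forall>n x. (D n has_vector_derivative D (Suc n) x) (at x))) \<and>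
     compact (closure {x. \<phi> x \<noteq> 0}) \<and> closure {x. \<phi> x \<noteq> 0} \<subseteq> S"

definition weak_derivative ::
  "real set \<Rightarrow> (real \<Rightarrow> complex) \<Rightarrow> (real \<Rightarrow> complex) \<Rightarrow> bool" where
  "weak_derivative S f g \<longleftrightarrow>
     (\<forall>\<phi>. test_function S \<phi> \<longrightarrow>
        (\<integral>x. f x * vector_derivative \<phi> (at x) \<partial>(lebesgue_on S)) =
        - (\<integral>x. g x * \<phi> x \<partial>(lebesgue_on S)))"

definition H1 :: "real set \<Rightarrow> (real \<Rightarrow> complex) set" where
  "H1 S = {f \<in> L2 S. \<exists>g \<in> L2 S. weak_derivative S f g}"

text \<open>Functions are not identified almost everywhere, so a weak derivative is determined
  only up to null sets; the choice of representative does not affect the norm.\<close>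

definition H1_norm_sq :: "real set \<Rightarrow> (real \<Rightarrow> complex) \<Rightarrow> real" where
  "H1_norm_sq S f =
     L2_norm_sq S f + L2_norm_sq S (SOME g. g \<in> L2 S \<and> weak_derivative S f g)"

text \<open>An element of the direct sum of \<open>H\<^sup>1\<close> of the two half-lines is encoded as one function on
  the line; its value at \<open>0\<close> is irrelevant, and no matching condition is imposed there.\<close>

definition Q :: "(real \<Rightarrow> complex) set" where
  "Q = {f. f \<in> H1 {0<..} \<and> f \<in> H1 {..<0}}"

definition Q_norm :: "(real \<Rightarrow> complex) \<Rightarrow> real" where
  "Q_norm f = sqrt (H1_norm_sq {0<..} f + H1_norm_sq {..<0} f)"

definition tendsto_Q ::
  "('a \<Rightarrow> real \<Rightarrow> complex) \<Rightarrow> (real \<Rightarrow> complex) \<Rightarrow> 'a filter \<Rightarrow> bool" where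
  "tendsto_Q f l F \<longleftrightarrow>
     l \<in> Q \<and> (\<forall>\<^sub>F t in F. f t \<in> Q) \<and>
     ((\<lambda>t. Q_norm (\<lambda>x. f t x - l x)) \<longlongrightarrow> 0) F"

definition locally_integrable :: "(real \<Rightarrow> complex) \<Rightarrow> bool" where
  "locally_integrable f \<longleftrightarrow> (\<forall>K. compact K \<longrightarrow> integrable (lebesgue_on K) f)"

text \<open>A locally integrable \<open>f\<close> is identified with the distribution
  \<open>\<phi> \<mapsto> \<integral> f \<phi>\<close>.\<close>

definition tendsto_distribution ::
  "('a \<Rightarrow> real \<Rightarrow> complex) \<Rightarrow> (real \<Rightarrow> complex) \<Rightarrow> 'a filter \<Rightarrow> bool" where
  "tendsto_distribution f l F \<longleftrightarrow>
     locally_integrable l \<and> (\<forall>\<^sub>F t in F. locally_integrable (f t)) \<and>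
     (\<forall>\<phi>. test_function UNIV \<phi> \<longrightarrow>
        ((\<lambda>t. \<integral>x. f t x * \<phi> x \<partial>lebesgue) \<longlongrightarrow> (\<integral>x. l x * \<phi> x \<partial>lebesgue)) F)"


section \<open>Stationary states\<close>

definition sech :: "real \<Rightarrow> real" where
  "sech x = 1 / cosh x"

definition t1 :: "real \<Rightarrow> real \<Rightarrow> real" where
  "t1 \<gamma> \<omega> =
     (1 - sqrt (1 + \<gamma>\<^sup>2 * \<omega>) + sqrt (\<gamma>\<^sup>2 * \<omega> - 2 + 2 * sqrt (1 + \<gamma>\<^sup>2 * \<omega>)))
       / (2 * \<gamma> * sqrt \<omega>)"

definition t2 :: "real \<Rightarrow> real \<Rightarrow> real" where
  "t2 \<gamma> \<omega> =
     (- 1 + sqrt (1 + \<gamma>\<^sup>2 * \<omega>) + sqrt (\<gamma>\<^sup>2 * \<omega> - 2 + 2 * sqrt (1 + \<gamma>\<^sup>2 * \<omega>)))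
       / (2 * \<gamma> * sqrt \<omega>)"

datatype sign = Plus | Minus

definition shift :: "real \<Rightarrow> real \<Rightarrow> real" where
  "shift \<omega> t = 1 / (2 * sqrt \<omega>) * ln ((1 + t) / (1 - t))"

fun x1 :: "sign \<Rightarrow> real \<Rightarrow> real \<Rightarrow> real" where
  "x1 Plus \<gamma> \<omega> = shift \<omega> (t1 \<gamma> \<omega>)"
| "x1 Minus \<gamma> \<omega> = - shift \<omega> (t2 \<gamma> \<omega>)"

fun x2 :: "sign \<Rightarrow> real \<Rightarrow> real \<Rightarrow> real" where
  "x2 Plus \<gamma> \<omega> = shift \<omega> (t2 \<gamma> \<omega>)"
| "x2 Minus \<gamma> \<omega> = - shift \<omega> (t1 \<gamma> \<omega>)"

definition xbar :: "real \<Rightarrow> real \<Rightarrow> real" where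
  "xbar \<gamma> \<omega> = 1 / (2 * sqrt \<omega>) * ln ((\<gamma> * sqrt \<omega> + 2) / (\<gamma> * sqrt \<omega> - 2))"

text \<open>The value \<open>0\<close> at the origin in the next two definitions is an arbitrary convention.\<close>

definition psi_plus :: "sign \<Rightarrow> real \<Rightarrow> real \<Rightarrow> real \<Rightarrow> real \<Rightarrow> complex" where
  "psi_plus s lam \<gamma> \<omega> x = complex_of_real
     (if x < 0 then sqrt (2 * \<omega> / lam) * sech (sqrt \<omega> * (x - x1 s \<gamma> \<omega>))
      else if x > 0 then sqrt (2 * \<omega> / lam) * sech (sqrt \<omega> * (x - x2 s \<gamma> \<omega>))
      else 0)"

definition psi_minus :: "real \<Rightarrow> real \<Rightarrow> real \<Rightarrow> real \<Rightarrow> complex" where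
  "psi_minus lam \<gamma> \<omega> x = complex_of_real
     (if x < 0 then - sqrt (2 * \<omega> / lam) * sech (sqrt \<omega> * (x - xbar \<gamma> \<omega>))
      else if x > 0 then sqrt (2 * \<omega> / lam) * sech (sqrt \<omega> * (x + xbar \<gamma> \<omega>))
      else 0)"

text \<open>The member of mass \<open>\<rho>\<close> of a family indexed by \<open>\<omega> \<in> W\<close>; meaningful when the mass
  takes the value \<open>\<rho>\<close> exactly once on \<open>W\<close>.\<close>

definition member_of_mass ::
  "real set \<Rightarrow> (real \<Rightarrow> real \<Rightarrow> complex) \<Rightarrow> real \<Rightarrow> real \<Rightarrow> complex" where
  "member_of_mass W \<psi> \<rho> = \<psi> (THE \<omega>. \<omega> \<in> W \<and> L2_norm_sq UNIV (\<psi> \<omega>) = \<rho>)"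

definition phi_plus :: "sign \<Rightarrow> real \<Rightarrow> real \<Rightarrow> real \<Rightarrow> real \<Rightarrow> complex" where
  "phi_plus s lam \<rho> \<gamma> = member_of_mass {0<..} (psi_plus s lam \<gamma>) \<rho>"

definition phi_minus :: "real \<Rightarrow> real \<Rightarrow> real \<Rightarrow> real \<Rightarrow> complex" where
  "phi_minus lam \<rho> \<gamma> = member_of_mass {4 / \<gamma>\<^sup>2 <..} (psi_minus lam \<gamma>) \<rho>"

end

theory Submission
  imports Defs "HOL-Real_Asymp.Real_Asymp"
begin

text \<open>
  On each half-line every function of the two families is a soliton
  \<open>A sech (\<surd>\<omega> x - a)\<close>, so everything reduces to the behaviour of the three parameters.

  Since \<open>sech\<^sup>2\<close> has the primitive \<open>tanh\<close>, and since the shifts of the first family are chosen so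
  that the hyperbolic tangents of the two phases are \<open>t\<^sub>1, t\<^sub>2\<close> up to sign, the mass of a member of
  that family is \<open>(2/\<lambda>) (2 \<surd>\<omega> + (\<surd>(1 + \<gamma>\<^sup>2 \<omega>) - 1) / \<gamma>)\<close> for either sign
  (\<open>L2_norm_sq_psi_plus\<close>). This is strictly increasing in \<open>\<omega>\<close>, and when it is set equal to \<open>\<rho>\<close>
  the second summand is of order \<open>\<gamma>\<close>, so that \<open>\<surd>\<omega> \<rightarrow> \<lambda>\<rho>/4\<close> as \<open>\<gamma> \<rightarrow> 0+\<close>
  (\<open>phi_plus_frequency\<close>). Then \<open>t\<^sub>1\<close> and \<open>t\<^sub>2\<close>, which depend only on \<open>\<gamma> \<surd>\<omega>\<close>, both tend to
  \<open>1/\<surd>2\<close>: the phases on the two half-lines have the common limit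
  \<open>artanh (1/\<surd>2) = ln (3 + 2 \<surd>2) / 2\<close> up to sign, and the limit function has no jump at \<open>0\<close>.
  Convergence of the parameters gives convergence of the functions and of their classical
  derivatives in \<open>L\<^sup>2\<close> by dominated convergence, a multiple of \<open>sech (c x)\<close> being a common majorant
  (\<open>soliton_L2_convergence\<close>).

  The norm of \<open>H\<^sup>1\<close> is defined through an unspecified weak derivative. To replace it by
  the classical one, two facts are proved: a continuous classical derivative is a weak
  derivative (\<open>weak_derivative_if_classical\<close>), and weak derivatives in \<open>L\<^sup>2\<close> are unique almost
  everywhere (\<open>weak_derivative_unique\<close>). The second is the fundamental lemma of the calculus of
  variations, for which smooth bump functions converging to the indicator of an interval are built
  from \<open>exp (-1/x)\<close>.

  In the second family the mass is \<open>(4/\<lambda>) (\<surd>\<omega> - 2/\<gamma>)\<close>, so that the member of mass \<open>\<rho>\<close> has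
  \<open>\<surd>\<omega> = 2/\<gamma> + \<lambda>\<rho>/4\<close> exactly. Its profile concentrates at \<open>0\<close> with fixed \<open>L\<^sup>2\<close> norm, but its phase
  \<open>artanh (2 / (\<gamma> \<surd>\<omega>))\<close> tends to infinity because \<open>\<gamma> \<surd>\<omega> \<rightarrow> 2\<close>; hence its \<open>L\<^sup>1\<close> norm tends to
  \<open>0\<close> (\<open>antisymmetric_solitons_integrable\<close>), which implies convergence to \<open>0\<close> in the sense of
  distributions.
\<close>

section \<open>Smooth bump functions\<close>

text \<open>This reduces smoothness to exhibiting a family that is closed under differentiation, which avoids
  formulas for the higher derivatives of a product.\<close>

lemma family_closed_under_derivative_smooth:
  fixes A :: "(real \<Rightarrow> real) set"
  assumes step: "\<And>f. f \<in> A \<Longrightarrow> \<exists>g\<in>A. \<forall>x. (f has_real_derivative g x) (at x)"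
    and "f \<in> A"
  shows "\<exists>D. D 0 = f \<and> (\<forall>n x. (D n has_real_derivative D (Suc n) x) (at x))"
proof -
  have "\<exists>D. \<forall>n. (D n \<in> A \<and> (n = 0 \<longrightarrow> D n = f)) \<and>
          (\<forall>x. (D n has_real_derivative D (Suc n) x) (at x))"
  proof (rule dependent_nat_choice)
    show "\<exists>g. g \<in> A \<and> (0 = (0::nat) \<longrightarrow> g = f)"
      using \<open>f \<in> A\<close> by blast
  next
    fix g and n :: nat
    assume "g \<in> A \<and> (n = 0 \<longrightarrow> g = f)"
    then show "\<exists>h. (h \<in> A \<and> (Suc n = 0 \<longrightarrow> h = f)) \<and> (\<forall>x. (g has_real_derivative h x) (at x))"
      using step[of g] by auto
  qed
  then show ?thesis by metis
qed

text \<open>The derivatives of \<open>exp (-1/x)\<close>, extended by \<open>0\<close> to \<open>x \<le> 0\<close>, all have this form; admitting a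
  polynomial factor makes the class closed under differentiation.\<close>

definition flat :: "real poly \<Rightarrow> real \<Rightarrow> real" where
  "flat p x = (if x > 0 then poly p (1 / x) * exp (- 1 / x) else 0)"

lemma tendsto_poly_times_exp_minus:
  fixes p :: "real poly"
  shows "((\<lambda>y. poly p y * exp (- y)) \<longlongrightarrow> 0) at_top"
proof -
  have "((\<lambda>y. \<Sum>i\<le>degree p. coeff p i * (y ^ i / exp y)) \<longlongrightarrow> (\<Sum>i\<le>degree p. coeff p i * 0)) at_top"
    by (intro tendsto_intros tendsto_power_div_exp_0)
  then show ?thesis
    by (simp add: poly_altdef sum_distrib_right exp_minus divide_inverse mult.assoc)
qed

text \<open>For \<open>x > 0\<close> this is the chain rule, the factor \<open>X\<^sup>2\<close> being the derivative of \<open>1/x\<close> up to sign. At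
  \<open>0\<close> the difference quotient from the right is \<open>y p(y) exp (-y)\<close> with \<open>y = 1/x\<close>, which vanishes as
  \<open>y \<rightarrow> \<infinity>\<close>.\<close>

lemma flat_has_derivative:
  "(flat p has_real_derivative flat ([:0, 0, 1:] * (p - pderiv p)) x) (at x)"
proof -
  consider "x > 0" | "x < 0" | "x = 0" by linarith
  then show ?thesis
  proof cases
    case 1
    have "((\<lambda>x. poly p (1 / x) * exp (- 1 / x)) has_real_derivative
        flat ([:0, 0, 1:] * (p - pderiv p)) x) (at x)"
    proof -
      have 1: "((\<lambda>x. - 1 / x) has_real_derivative 1 / x\<^sup>2) (at x)"
        "((\<lambda>x. 1 / x) has_real_derivative - 1 / x\<^sup>2) (at x)"
        using 1 by (auto intro!: derivative_eq_intros simp: power2_eq_square)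
      show ?thesis
        using DERIV_mult[OF DERIV_chain2[OF poly_DERIV[of p] 1(2)] DERIV_chain2[OF DERIV_exp 1(1)]]
           \<open>x > 0\<close>
        by (simp add: flat_def field_simps power2_eq_square)
    qed
    then show ?thesis
      by (rule has_field_derivative_transform_within_open[where S = "{0<..}"])
        (use 1 in \<open>auto simp: flat_def\<close>)
  next
    case 2
    have "((\<lambda>x. 0) has_real_derivative flat ([:0, 0, 1:] * (p - pderiv p)) x) (at x)"
      using 2 by (simp add: flat_def)
    then show ?thesis
      by (rule has_field_derivative_transform_within_open[where S = "{..<0}"])
        (use 2 in \<open>auto simp: flat_def\<close>)
  next
    case 3
    have "((\<lambda>y. flat p y / y) \<longlongrightarrow> 0) (at_right 0)"
    proof (rule Lim_transform_eventually)
      show "((\<lambda>y. poly (pCons 0 p) (inverse y) * exp (- inverse y)) \<longlongrightarrow> 0) (at_right 0)"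
        by (rule filterlim_compose[OF tendsto_poly_times_exp_minus filterlim_inverse_at_top_right])
      show "\<forall>\<^sub>F y in at_right 0. poly (pCons 0 p) (inverse y) * exp (- inverse y) = flat p y / y"
        using eventually_at_right_less[of 0]
        by (rule eventually_mono) (simp add: flat_def divide_inverse)
    qed
    moreover have "((\<lambda>y. flat p y / y) \<longlongrightarrow> 0) (at_left 0)"
      by (rule Lim_transform_eventually[OF tendsto_const])
        (auto simp: flat_def eventually_at_filter)
    ultimately have "((\<lambda>y. flat p y / y) \<longlongrightarrow> 0) (at 0)"
      by (simp add: filterlim_split_at)
    then show ?thesis
      using 3 by (simp add: has_field_derivative_iff flat_def)
  qed
qed

text \<open>Finite sums of products of two such functions: a family that contains the bump function below and is
  closed under differentiation. Scalar factors need no clause of their own: they are absorbed by the polynomials.\<close>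

inductive_set bump_span :: "real \<Rightarrow> real \<Rightarrow> real \<Rightarrow> (real \<Rightarrow> real) set" for c a b where
  prod: "(\<lambda>x. flat p (c * (x - a)) * flat q (c * (b - x))) \<in> bump_span c a b"
| add: "f \<in> bump_span c a b \<Longrightarrow> g \<in> bump_span c a b \<Longrightarrow> (\<lambda>x. f x + g x) \<in> bump_span c a b"

lemma flat_smult: "flat (smult k p) x = k * flat p x"
  by (simp add: flat_def)

lemma bump_span_derivative:
  assumes "f \<in> bump_span c a b"
  shows "\<exists>g\<in>bump_span c a b. \<forall>x. (f has_real_derivative g x) (at x)"
  using assms
proof induction
  case (prod p q)
  let ?d = "\<lambda>p. [:0, 0, 1:] * (p - pderiv p)"
  let ?g = "\<lambda>x. flat (smult c (?d p)) (c * (x - a)) * flat q (c * (b - x)) +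
                flat p (c * (x - a)) * flat (smult (- c) (?d q)) (c * (b - x))"
  have "((\<lambda>x. flat p (c * (x - a)) * flat q (c * (b - x))) has_real_derivative ?g x) (at x)" for x
  proof -
    have l: "((\<lambda>x. c * (x - a)) has_real_derivative c) (at x)"
      "((\<lambda>x. c * (b - x)) has_real_derivative - c) (at x)"
      by (auto intro!: derivative_eq_intros)
    show ?thesis
      using DERIV_mult[OF DERIV_chain2[OF flat_has_derivative l(1)] DERIV_chain2[OF flat_has_derivative l(2)]]
      unfolding flat_smult by (simp add: mult.commute mult.left_commute)
  qed
  moreover have "?g \<in> bump_span c a b"
    by (intro bump_span.intros)
  ultimately show ?case by (intro bexI[of _ ?g] allI)
next
  case (add f g)
  then obtain f' g' where "f' \<in> bump_span c a b" "g' \<in> bump_span c a b"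
    "\<And>x. (f has_real_derivative f' x) (at x)" "\<And>x. (g has_real_derivative g' x) (at x)"
    by blast
  then show ?case
    by (intro bexI[of _ "\<lambda>x. f' x + g' x"]) (auto intro: bump_span.add DERIV_add)
qed

text \<open>On \<open>]a, b[\<close> this is the \<open>1/c\<close>-th power of a fixed bump function supported in \<open>[a, b]\<close>, which is why
  it increases to the indicator of the open interval as \<open>c\<close> grows.\<close>

definition bump :: "real \<Rightarrow> real \<Rightarrow> real \<Rightarrow> real \<Rightarrow> real" where
  "bump c a b x = flat 1 (c * (x - a)) * flat 1 (c * (b - x))"

lemma bump_bounds: "0 \<le> bump c a b x" "bump c a b x \<le> 1"
proof -
  have "0 \<le> flat 1 y \<and> flat 1 y \<le> 1" for y :: real
    by (simp add: flat_def)
  then show "0 \<le> bump c a b x" "bump c a b x \<le> 1"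
    unfolding bump_def by (auto intro: mult_le_one)
qed

lemma bump_outside:
  assumes "c > 0" "x \<notin> {a<..<b}"
  shows "bump c a b x = 0"
  using assms by (auto simp: bump_def flat_def zero_less_mult_iff)

lemma test_function_bump:
  assumes "c > 0" "{a..b} \<subseteq> S"
  shows "test_function S (\<lambda>x. complex_of_real (bump c a b x))"
proof -
  have "bump c a b \<in> bump_span c a b"
    unfolding bump_def [abs_def] by (rule bump_span.prod)
  from family_closed_under_derivative_smooth[OF bump_span_derivative this]
  obtain D where D: "D 0 = bump c a b" "\<And>n x. (D n has_real_derivative D (Suc n) x) (at x)"
    by blast
  have cl: "closure {x. complex_of_real (bump c a b x) \<noteq> 0} \<subseteq> {a..b}"
  proof (rule closure_minimal)
    show "{x. complex_of_real (bump c a b x) \<noteq> 0} \<subseteq> {a..b}"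
    proof
      fix x assume "x \<in> {x. complex_of_real (bump c a b x) \<noteq> 0}"
      then have "x \<in> {a<..<b}"
        using bump_outside[OF \<open>c > 0\<close>, of x a b] by auto
      then show "x \<in> {a..b}" by auto
    qed
  qed simp
  show ?thesis
    unfolding test_function_def
  proof (intro conjI exI[of _ "\<lambda>n x. complex_of_real (D n x)"] allI)
    show "((\<lambda>x. complex_of_real (D n x)) has_vector_derivative complex_of_real (D (Suc n) x)) (at x)" for n x
      using D(2) by (intro has_vector_derivative_of_real)
          (simp add: has_real_derivative_iff_has_vector_derivative)
    show "compact (closure {x. complex_of_real (bump c a b x) \<noteq> 0})"
      using cl by (meson bounded_closed_interval bounded_subset closed_closure compact_eq_bounded_closed)
  qed (use D cl assms in auto)
qed

lemma bump_tendsto_indicator: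
  "(\<lambda>n. bump (Suc n) a b x) \<longlonglongrightarrow> indicator {a<..<b} x"
proof (cases "x \<in> {a<..<b}")
  case True
  have *: "(\<lambda>n. exp (- 1 / (real (Suc n) * d))) \<longlonglongrightarrow> 1" for d :: real
  proof -
    have "(\<lambda>n. exp (- 1 / d * (1 / real (Suc n)))) \<longlonglongrightarrow> exp (- 1 / d * 0)"
      by (intro tendsto_intros LIMSEQ_Suc[OF lim_1_over_n])
    then show ?thesis by (simp add: field_simps)
  qed
  have "(\<lambda>n. exp (- 1 / (real (Suc n) * (x - a))) * exp (- 1 / (real (Suc n) * (b - x)))) \<longlonglongrightarrow> 1 * 1"
    by (intro tendsto_mult *)
  then show ?thesis
    using True by (simp add: bump_def flat_def del: of_nat_Suc)
next
  case False
  then show ?thesis using bump_outside[OF _ False] by simp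
qed

lemma bump_continuous: "continuous_on A (bump c a b)"
proof -
  have "bump c a b \<in> bump_span c a b"
    unfolding bump_def [abs_def] by (rule bump_span.prod)
  then obtain g where "\<forall>x. (bump c a b has_real_derivative g x) (at x)"
    using bump_span_derivative by blast
  then show ?thesis by (meson DERIV_isCont continuous_at_imp_continuous_on)
qed

section \<open>The fundamental lemma of the calculus of variations\<close>

lemma sigma_finite_lebesgue: "sigma_finite_measure (lebesgue :: real measure)"
proof
  show "\<exists>A. countable A \<and> A \<subseteq> sets (lebesgue :: real measure) \<and> \<Union> A = space lebesgue \<and>
          (\<forall>a\<in>A. emeasure lebesgue a \<noteq> \<infinity>)"
  proof (intro exI[of _ "range (\<lambda>n::nat. {- real n..real n})"] conjI)
    have "\<exists>n. x \<in> {- real n..real n}" for x :: real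
      using real_arch_simple[of "\<bar>x\<bar>"] by (auto simp: abs_le_iff) (metis minus_le_iff)
    then show "\<Union> (range (\<lambda>n::nat. {- real n..real n})) = space (lebesgue :: real measure)"
      by auto
  qed auto
qed

text \<open>The open rays generate the Borel sets and are stable under intersection, so a Dynkin argument
  makes the integral over every Borel set vanish; a Lebesgue measurable set differs from a Borel
  set by a null set.\<close>

lemma AE_zero_of_ray_integrals:
  fixes k :: "real \<Rightarrow> 'a::{banach, second_countable_topology}"
  assumes k: "integrable lebesgue k"
    and total: "(\<integral>x. k x \<partial>lebesgue) = 0"
    and rays: "\<And>a. set_lebesgue_integral lebesgue {a<..} k = 0"
  shows "AE x in lebesgue. k x = 0"
proof -
  have si: "set_integrable lebesgue A k" if "A \<in> sets lebesgue" for A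
    unfolding set_integrable_def by (rule integrable_mult_indicator[OF that k])
  have sig: "A \<in> sets lebesgue" if "A \<in> sigma_sets UNIV (range greaterThan)" for A :: "real set"
  proof -
    have "A \<in> sets borel" using that by (simp add: borel_Ioi)
    then show ?thesis by simp
  qed
  have bor: "set_lebesgue_integral lebesgue A k = 0" if "A \<in> sets borel" for A
  proof -
    have "Int_stable (range (greaterThan :: real \<Rightarrow> _))"
    proof -
      have "{a<..} \<inter> {b<..} = {max a b<..}" for a b :: real by auto
      then show ?thesis by (auto simp: Int_stable_def)
    qed
    moreover have "range greaterThan \<subseteq> Pow (UNIV :: real set)" by simp
    moreover have "A \<in> sigma_sets UNIV (range greaterThan)"
      using that by (simp add: borel_Ioi)
    ultimately show ?thesis
    proof (induction rule: sigma_sets_induct_disjoint)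
      case (compl A)
      then have A: "A \<in> sets lebesgue"
        by (intro sig)
      have "set_lebesgue_integral lebesgue (A \<union> (UNIV - A)) k
          = set_lebesgue_integral lebesgue A k + set_lebesgue_integral lebesgue (UNIV - A) k"
        using A by (intro set_integral_Un si) auto
      then show ?case
        using compl total by (simp add: set_lebesgue_integral_def)
    next
      case (union A)
      then have A: "A i \<in> sets lebesgue" for i
        by (intro sig) auto
      have "set_lebesgue_integral lebesgue (\<Union>i. A i) k = (\<Sum>i. set_lebesgue_integral lebesgue (A i) k)"
        using A union(1) by (intro lebesgue_integral_countable_add si) (auto simp: disjoint_family_on_def)
      then show ?case using union by simp
    qed (use rays in \<open>auto simp: set_lebesgue_integral_def\<close>)
  qed
  have "set_lebesgue_integral lebesgue A k = 0" if A: "A \<in> sets lebesgue" for A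
  proof -
    obtain S N N' where *: "A = S \<union> N" "N \<subseteq> N'" "N' \<in> null_sets lborel" "S \<in> sets borel"
      using sets_completionE[OF A] by (metis sets_lborel)
    have "AE x in lebesgue. x \<notin> N'"
      using *(3) by (intro AE_completion AE_not_in)
    then have "AE x in lebesgue. indicator A x *\<^sub>R k x = indicator S x *\<^sub>R k x"
      by eventually_elim (use * in \<open>auto simp: indicator_def\<close>)
    then have "set_lebesgue_integral lebesgue A k = set_lebesgue_integral lebesgue S k"
      unfolding set_lebesgue_integral_def
      using A *(4) by (intro integral_cong_AE borel_measurable_scaleR borel_measurable_indicator
          borel_measurable_integrable[OF k]) auto
    then show ?thesis using bor * by simp
  qed
  then show ?thesis
    by (intro sigma_finite_measure.density_zero[OF sigma_finite_lebesgue k]) auto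
qed

text \<open>Testing against bump functions that converge to the indicator of a subinterval shows that all
  integrals over subintervals vanish.\<close>

lemma AE_zero_on_interval_of_test_functions:
  fixes k :: "real \<Rightarrow> complex"
  assumes k: "integrable (lebesgue_on {a..b}) k"
    and test: "\<And>\<phi>. test_function {a..b} \<phi> \<Longrightarrow> (\<integral>x. k x * \<phi> x \<partial>(lebesgue_on {a..b})) = 0"
  shows "AE x in lebesgue. x \<in> {a<..<b} \<longrightarrow> k x = 0"
proof -
  define h where "h x = indicator {a..b} x *\<^sub>R k x" for x
  have h: "integrable lebesgue h"
    using k unfolding h_def by (subst (asm) integrable_restrict_space) auto
  have int0: "(\<integral>x. indicator {c<..<d} x *\<^sub>R h x \<partial>lebesgue) = 0" if "{c..d} \<subseteq> {a..b}" for c d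
  proof -
    have "(\<lambda>n. \<integral>x. complex_of_real (bump (Suc n) c d x) * h x \<partial>lebesgue)
        \<longlonglongrightarrow> (\<integral>x. complex_of_real (indicator {c<..<d} x) * h x \<partial>lebesgue)"
    proof (rule integral_dominated_convergence)
      show "integrable lebesgue (\<lambda>x. norm (h x))" using h by simp
      show "(\<lambda>x. complex_of_real (bump (real (Suc n)) c d x) * h x) \<in> borel_measurable lebesgue" for n
        using h continuous_imp_measurable_on_sets_lebesgue[OF bump_continuous[of UNIV "real (Suc n)" c d]]
        by (intro borel_measurable_times borel_measurable_of_real) auto
      show "AE x in lebesgue. (\<lambda>n. complex_of_real (bump (real (Suc n)) c d x) * h x)
          \<longlonglongrightarrow> complex_of_real (indicat_real {c<..<d} x) * h x"
        by (intro AE_I2 tendsto_intros bump_tendsto_indicator)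
      show "AE x in lebesgue. norm (complex_of_real (bump (real (Suc n)) c d x) * h x) \<le> norm (h x)" for n
        using bump_bounds[of "real (Suc n)" c d]
        by (intro AE_I2) (simp add: norm_mult mult_left_le_one_le del: of_nat_Suc)
      show "(\<lambda>x. complex_of_real (indicat_real {c<..<d} x) * h x) \<in> borel_measurable lebesgue"
        using h by (intro borel_measurable_times measurable_compose[OF _ borel_measurable_of_real] borel_measurable_indicator) auto
    qed
    moreover have "(\<integral>x. complex_of_real (bump (Suc n) c d x) * h x \<partial>lebesgue) = 0" for n
    proof -
      have "(\<integral>x. k x * complex_of_real (bump (Suc n) c d x) \<partial>(lebesgue_on {a..b})) = 0"
        by (intro test test_function_bump) (use that in auto)
      then show ?thesis
        by (subst (asm) integral_restrict_space) (simp_all add: h_def mult_ac)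
    qed
    ultimately have "(\<integral>x. complex_of_real (indicator {c<..<d} x) * h x \<partial>lebesgue) = 0"
      using LIMSEQ_unique[OF _ tendsto_const] by simp
    then show ?thesis by (simp add: scaleR_conv_of_real)
  qed
  have "AE x in lebesgue. indicator {a<..<b} x *\<^sub>R h x = 0"
  proof (rule AE_zero_of_ray_integrals)
    show "integrable lebesgue (\<lambda>x. indicat_real {a<..<b} x *\<^sub>R h x)"
      using h by (rule integrable_mult_indicator[rotated]) auto
    show "(\<integral>x. indicat_real {a<..<b} x *\<^sub>R h x \<partial>lebesgue) = 0"
      by (rule int0) simp
    show "set_lebesgue_integral lebesgue {e<..} (\<lambda>x. indicat_real {a<..<b} x *\<^sub>R h x) = 0" for e
    proof -
      have "indicat_real {e<..} x *\<^sub>R (indicat_real {a<..<b} x *\<^sub>R h x)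
          = indicat_real {max a e<..<b} x *\<^sub>R h x" for x
        by (auto simp: indicator_def)
      then show ?thesis
        unfolding set_lebesgue_integral_def by (simp only:) (rule int0, auto)
    qed
  qed
  then show ?thesis
    by eventually_elim (auto simp: h_def split: if_splits)
qed

lemma test_function_mono: "test_function T \<phi> \<Longrightarrow> T \<subseteq> S \<Longrightarrow> test_function S \<phi>"
  by (auto simp: test_function_def)

text \<open>An open set \<open>S\<close> is the union of the countably many intervals \<open>]p, q[\<close> with rational end points and
  \<open>[p, q] \<subseteq> S\<close>, so the statement on intervals suffices.\<close>

lemma fundamental_lemma_calculus_of_variations:
  fixes k :: "real \<Rightarrow> complex"
  assumes "open S"
    and k: "\<And>a b. {a..b} \<subseteq> S \<Longrightarrow> integrable (lebesgue_on {a..b}) k"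
    and test: "\<And>\<phi>. test_function S \<phi> \<Longrightarrow> (\<integral>x. k x * \<phi> x \<partial>(lebesgue_on S)) = 0"
  shows "AE x in lebesgue_on S. k x = 0"
proof -
  have S: "S \<in> sets lebesgue" using \<open>open S\<close> by (simp add: borel_open)
  have zero: "AE x in lebesgue. x \<in> {a<..<b} \<longrightarrow> k x = 0" if "{a..b} \<subseteq> S" for a b
  proof (rule AE_zero_on_interval_of_test_functions[OF k[OF that]])
    fix \<phi> assume \<phi>: "test_function {a..b} \<phi>"
    then have "\<phi> x = 0" if "x \<notin> {a..b}" for x
      using that closure_subset[of "{x. \<phi> x \<noteq> 0}"] unfolding test_function_def by blast
    then have *: "indicat_real {a..b} x *\<^sub>R (k x * \<phi> x) = indicat_real S x *\<^sub>R (k x * \<phi> x)" for x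
      using that by (auto simp: indicator_def)
    have "(\<integral>x. k x * \<phi> x \<partial>(lebesgue_on {a..b})) = (\<integral>x. k x * \<phi> x \<partial>(lebesgue_on S))"
      using S by (subst (1 2) integral_restrict_space) (simp_all only: *, auto)
    then show "(\<integral>x. k x * \<phi> x \<partial>(lebesgue_on {a..b})) = 0"
      using test[OF test_function_mono[OF \<phi> that]] by simp
  qed
  define P where "P = {(a, b). a \<in> \<rat> \<and> b \<in> \<rat> \<and> {a..b} \<subseteq> S}"
  have "countable P"
    by (rule countable_subset[of _ "\<rat> \<times> \<rat>"]) (auto simp: P_def intro: countable_rat)
  then have all: "AE x in lebesgue. \<forall>p\<in>P. x \<in> {fst p<..<snd p} \<longrightarrow> k x = 0"
    by (intro AE_ball_countable[THEN iffD2] ballI zero) (auto simp: P_def)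
  have cover: "\<exists>p\<in>P. x \<in> {fst p<..<snd p}" if x: "x \<in> S" for x
  proof -
    obtain e where e: "e > 0" "\<And>y. \<bar>y - x\<bar> < e \<Longrightarrow> y \<in> S"
      using \<open>open S\<close>[unfolded open_dist, rule_format, OF x] by (auto simp: dist_real_def)
    obtain p where p: "p \<in> \<rat>" "x - e < p" "p < x"
      using Rats_dense_in_real[of "x - e" x] e(1) by auto
    obtain q where q: "q \<in> \<rat>" "x < q" "q < x + e"
      using Rats_dense_in_real[of x "x + e"] e(1) by auto
    have "{p..q} \<subseteq> S"
    proof
      fix y assume "y \<in> {p..q}"
      then have "\<bar>y - x\<bar> < e" using p q by (auto simp: abs_less_iff)
      then show "y \<in> S" by (rule e(2))
    qed
    then have "(p, q) \<in> P" "x \<in> {fst (p, q)<..<snd (p, q)}"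
      using p q by (auto simp: P_def)
    then show ?thesis by blast
  qed
  have "AE x in lebesgue. x \<in> S \<longrightarrow> k x = 0"
    using all by eventually_elim (use cover in metis)
  then show ?thesis
    using S by (subst AE_restrict_space_iff) auto
qed

section \<open>Weak derivatives and the Sobolev norm\<close>

lemma L2_cong: "(\<And>x. x \<in> S \<Longrightarrow> f x = g x) \<Longrightarrow> f \<in> L2 S \<longleftrightarrow> g \<in> L2 S"
  unfolding L2_def mem_Collect_eq
  by (intro conj_cong measurable_cong Bochner_Integration.integrable_cong) (auto simp: space_restrict_space)

lemma L2_norm_sq_cong: "(\<And>x. x \<in> S \<Longrightarrow> f x = g x) \<Longrightarrow> L2_norm_sq S f = L2_norm_sq S g"
  unfolding L2_norm_sq_def
  by (intro Bochner_Integration.integral_cong) (auto simp: space_restrict_space)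

lemma integrable_L2_mult:
  assumes "f \<in> L2 S" "g \<in> L2 S"
  shows "integrable (lebesgue_on S) (\<lambda>x. f x * g x)"
proof (rule Bochner_Integration.integrable_bound)
  show "integrable (lebesgue_on S) (\<lambda>x. (cmod (f x))\<^sup>2 + (cmod (g x))\<^sup>2)"
    using assms by (simp add: L2_def)
  show "(\<lambda>x. f x * g x) \<in> borel_measurable (lebesgue_on S)"
    using assms by (intro borel_measurable_times) (auto simp: L2_def)
  have "u * v \<le> u\<^sup>2 + v\<^sup>2" if "u \<ge> 0" "v \<ge> 0" for u v :: real
    using that sum_squares_bound[of u v] mult_nonneg_nonneg[OF that] by linarith
  then show "AE x in lebesgue_on S. cmod (f x * g x) \<le> norm ((cmod (f x))\<^sup>2 + (cmod (g x))\<^sup>2)"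
    by (intro AE_I2) (simp add: norm_mult)
qed

lemma L2_diff:
  assumes "f \<in> L2 S" "g \<in> L2 S"
  shows "(\<lambda>x. f x - g x) \<in> L2 S"
proof -
  have meas: "(\<lambda>x. f x - g x) \<in> borel_measurable (lebesgue_on S)"
    using assms by (intro borel_measurable_diff) (auto simp: L2_def)
  have "integrable (lebesgue_on S) (\<lambda>x. (cmod (f x - g x))\<^sup>2)"
  proof (rule Bochner_Integration.integrable_bound)
    show "integrable (lebesgue_on S) (\<lambda>x. 2 * (cmod (f x))\<^sup>2 + 2 * (cmod (g x))\<^sup>2)"
      using assms by (simp add: L2_def)
    have "(cmod (u - v))\<^sup>2 \<le> 2 * (cmod u)\<^sup>2 + 2 * (cmod v)\<^sup>2" for u v
    proof -
      have "(cmod (u - v))\<^sup>2 \<le> (cmod u + cmod v)\<^sup>2"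
        by (intro power_mono norm_triangle_ineq4) simp
      then show ?thesis
        using sum_squares_bound[of "cmod u" "cmod v"] by (simp add: power2_sum)
    qed
    then show "AE x in lebesgue_on S. norm ((cmod (f x - g x))\<^sup>2)
        \<le> norm (2 * (cmod (f x))\<^sup>2 + 2 * (cmod (g x))\<^sup>2)"
      by (intro AE_I2) simp
  qed (use meas in measurable)
  with meas show ?thesis by (simp add: L2_def)
qed

lemma L2_mono:
  assumes "f \<in> L2 S" "T \<subseteq> S" "S \<in> sets lebesgue" "T \<in> sets lebesgue"
  shows "f \<in> L2 T"
proof -
  have *: "f \<in> borel_measurable (lebesgue_on S)" "integrable (lebesgue_on S) (\<lambda>x. (cmod (f x))\<^sup>2)"
    using assms(1) by (simp_all add: L2_def)
  have "f \<in> borel_measurable (lebesgue_on T)"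
    using *(1) assms(2) by (rule measurable_restrict_mono)
  moreover have "set_integrable lebesgue S (\<lambda>x. (cmod (f x))\<^sup>2)"
    using *(2) assms(3) by (simp add: integrable_restrict_space set_integrable_def)
  then have "set_integrable lebesgue T (\<lambda>x. (cmod (f x))\<^sup>2)"
    using assms(4,2) by (rule set_integrable_subset)
  ultimately show ?thesis
    using assms(4) by (simp add: L2_def integrable_restrict_space set_integrable_def)
qed

lemma integrable_continuous_compact_support:
  fixes k :: "real \<Rightarrow> 'a::euclidean_space"
  assumes "continuous_on UNIV k" "\<And>x. x \<notin> {-M..M} \<Longrightarrow> k x = 0"
  shows "integrable lebesgue k" "(\<integral>x. k x \<partial>lebesgue) = integral {-M..M} k"
proof -
  have i: "integrable (lebesgue_on {-M..M}) k"
    using assms(1) by (intro continuous_imp_integrable_real) (rule continuous_on_subset, auto)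
  have e: "(\<lambda>x. indicat_real {-M..M} x *\<^sub>R k x) = k"
    using assms(2) by (auto simp: indicator_def)
  show "integrable lebesgue k"
    using i by (subst (asm) integrable_restrict_space) (auto simp: e)
  show "(\<integral>x. k x \<partial>lebesgue) = integral {-M..M} k"
    using lebesgue_integral_eq_integral[OF i] integral_restrict_space[of "{-M..M}" lebesgue k]
    by (simp add: e)
qed

lemma continuous_imp_lebesgue_measurable:
  fixes f :: "real \<Rightarrow> 'a::euclidean_space"
  shows "continuous_on UNIV f \<Longrightarrow> f \<in> borel_measurable lebesgue"
  using continuous_imp_measurable_on_sets_lebesgue[of UNIV f] by (simp add: lebesgue_on_UNIV_eq)

text \<open>The properties of a test function used below: one continuous derivative, and a common bounded
  support inside \<open>S\<close> for the function and its derivative.\<close>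

lemma test_functionE:
  assumes "test_function S \<phi>"
  obtains \<phi>' M where "\<And>x. (\<phi> has_vector_derivative \<phi>' x) (at x)"
    "continuous_on UNIV \<phi>" "continuous_on UNIV \<phi>'"
    "\<And>x. x \<notin> {-M..M} \<inter> S \<Longrightarrow> \<phi> x = 0" "\<And>x. x \<notin> {-M..M} \<inter> S \<Longrightarrow> \<phi>' x = 0"
proof -
  obtain D where D: "D 0 = \<phi>" "\<And>n x. (D n has_vector_derivative D (Suc n) x) (at x)"
    and K: "compact (closure {x. \<phi> x \<noteq> 0})" "closure {x. \<phi> x \<noteq> 0} \<subseteq> S"
    using assms unfolding test_function_def by blast
  define K where "K = closure {x. \<phi> x \<noteq> 0}"
  obtain M where M: "\<And>x. x \<in> K \<Longrightarrow> \<bar>x\<bar> \<le> M"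
    using compact_imp_bounded[OF K(1)] unfolding bounded_iff K_def by auto
  have cont: "continuous_on UNIV (D n)" for n
    using D(2) by (auto intro!: continuous_at_imp_continuous_on has_vector_derivative_continuous)
  have K0: "\<phi> x = 0" if "x \<notin> K" for x
    using that closure_subset[of "{x. \<phi> x \<noteq> 0}"] unfolding K_def by blast
  have K1: "D 1 x = 0" if "x \<notin> K" for x
  proof -
    have "(\<phi> has_vector_derivative D 1 x) (at x)"
      using D(2)[of 0 x] D(1) by simp
    then have "((\<lambda>_. 0) has_vector_derivative D 1 x) (at x)"
    proof (rule has_vector_derivative_transform_within_open)
      show "open (- K)" by (simp add: K_def open_Compl)
      show "x \<in> - K" using that by simp
      show "\<phi> y = 0" if "y \<in> - K" for y using that by (intro K0) simp
    qed
    then show ?thesis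
      by (rule vector_derivative_unique_at) (rule has_vector_derivative_const)
  qed
  have sub: "K \<subseteq> {-M..M} \<inter> S"
    using M K(2) by (force simp: K_def abs_le_iff)
  show ?thesis
  proof (rule that[of "D 1" M])
    show "(\<phi> has_vector_derivative D 1 x) (at x)" for x
      using D(2)[of 0 x] D(1) by simp
    show "continuous_on UNIV \<phi>" "continuous_on UNIV (D 1)"
      using cont[of 0] cont[of 1] D(1) by simp_all
    show "\<phi> x = 0" "D 1 x = 0" if "x \<notin> {-M..M} \<inter> S" for x
      using that sub by (intro K0 K1; blast)+
  qed
qed

lemma test_function_L2:
  assumes "test_function S \<phi>" "S \<in> sets lebesgue"
  shows "\<phi> \<in> L2 S"
proof -
  obtain M \<phi>' where \<phi>: "continuous_on UNIV \<phi>" "\<And>x. x \<notin> {-M..M} \<inter> S \<Longrightarrow> \<phi> x = 0"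
    using test_functionE[OF assms(1)] by metis
  have "\<phi> \<in> borel_measurable lebesgue"
    using \<phi>(1) by (rule continuous_imp_lebesgue_measurable)
  moreover have "integrable lebesgue (\<lambda>x. (cmod (\<phi> x))\<^sup>2)"
    using \<phi> by (intro integrable_continuous_compact_support(1)[of _ M] continuous_intros) auto
  ultimately have "\<phi> \<in> L2 UNIV"
    by (simp add: L2_def lebesgue_on_UNIV_eq)
  then show ?thesis by (rule L2_mono) (use assms in auto)
qed

text \<open>Integration by parts: the product \<open>F \<phi>\<close> vanishes at the ends of a large interval, so the integral of
  \<open>F \<phi>' + F' \<phi>\<close> over it is \<open>0\<close>. Since \<open>F\<close> is given on the whole line, that product is
  continuously differentiable on such an interval whatever the shape of \<open>S\<close>.\<close>

lemma weak_derivative_if_classical: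
  fixes F F' :: "real \<Rightarrow> complex"
  assumes S: "S \<in> sets lebesgue"
    and F: "\<And>x. (F has_vector_derivative F' x) (at x)" and F': "continuous_on UNIV F'"
    and f: "\<And>x. x \<in> S \<Longrightarrow> f x = F x" and g: "\<And>x. x \<in> S \<Longrightarrow> g x = F' x"
  shows "weak_derivative S f g"
  unfolding weak_derivative_def
proof (intro allI impI)
  fix \<phi> assume "test_function S \<phi>"
  then obtain \<phi>' M where d: "\<And>x. (\<phi> has_vector_derivative \<phi>' x) (at x)"
    and c: "continuous_on UNIV \<phi>" "continuous_on UNIV \<phi>'"
    and z: "\<And>x. x \<notin> {-M..M} \<inter> S \<Longrightarrow> \<phi> x = 0" "\<And>x. x \<notin> {-M..M} \<inter> S \<Longrightarrow> \<phi>' x = 0"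
    by (rule test_functionE) (rule that)
  have Fc: "continuous_on UNIV F"
    using F by (auto intro!: continuous_at_imp_continuous_on has_vector_derivative_continuous)
  \<comment> \<open>Enlarging the interval makes \<open>\<phi>\<close> vanish at its end points and keeps it nonempty.\<close>
  let ?N = "\<bar>M\<bar> + 1"
  have z': "\<phi> x = 0" "\<phi>' x = 0" if "x \<notin> {- ?N..?N}" for x
    using that by (auto intro!: z)
  note ics = integrable_continuous_compact_support[where M = ?N]
  have "((\<lambda>x. F x * \<phi>' x + F' x * \<phi> x) has_integral F ?N * \<phi> ?N - F (- ?N) * \<phi> (- ?N)) {- ?N..?N}"
  proof (rule fundamental_theorem_of_calculus)
    fix x
    show "((\<lambda>x. F x * \<phi> x) has_vector_derivative F x * \<phi>' x + F' x * \<phi> x) (at x within {- ?N..?N})"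
      by (rule has_vector_derivative_at_within[OF has_vector_derivative_mult[OF F d]])
  qed simp
  moreover have "\<phi> ?N = 0" by (rule z(1)) auto
  moreover have "\<phi> (- ?N) = 0" by (rule z(1)) auto
  ultimately have "integral {- ?N..?N} (\<lambda>x. F x * \<phi>' x + F' x * \<phi> x) = 0"
    by (simp add: integral_unique)
  then have "(\<integral>x. F x * \<phi>' x + F' x * \<phi> x \<partial>lebesgue) = 0"
    using z' by (subst ics(2)) (auto intro!: continuous_intros Fc F' c)
  moreover have "integrable lebesgue (\<lambda>x. F x * \<phi>' x)" "integrable lebesgue (\<lambda>x. F' x * \<phi> x)"
    using z' by (auto intro!: ics(1) continuous_intros Fc F' c)
  ultimately have *: "(\<integral>x. F x * \<phi>' x \<partial>lebesgue) = - (\<integral>x. F' x * \<phi> x \<partial>lebesgue)"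
    by (simp add: eq_neg_iff_add_eq_0)
  have "vector_derivative \<phi> (at x) = \<phi>' x" for x
    using d by (rule vector_derivative_at)
  moreover have "(\<lambda>x. indicat_real S x *\<^sub>R (f x * \<phi>' x)) = (\<lambda>x. F x * \<phi>' x)"
    "(\<lambda>x. indicat_real S x *\<^sub>R (g x * \<phi> x)) = (\<lambda>x. F' x * \<phi> x)"
    using z f g by (auto simp: indicator_def fun_eq_iff)
  ultimately show "(\<integral>x. f x * vector_derivative \<phi> (at x) \<partial>(lebesgue_on S)) =
      - (\<integral>x. g x * \<phi> x \<partial>(lebesgue_on S))"
    using * S by (simp add: integral_restrict_space)
qed

text \<open>The difference of two weak derivatives annihilates every test function; being square integrable,
  it is integrable on compact intervals.\<close>

lemma weak_derivative_unique:
  assumes "open S" and g: "g \<in> L2 S" "weak_derivative S f g" and h: "h \<in> L2 S" "weak_derivative S f h"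
  shows "AE x in lebesgue_on S. g x = h x"
proof -
  have S: "S \<in> sets lebesgue" using \<open>open S\<close> by (simp add: borel_open)
  have "AE x in lebesgue_on S. g x - h x = 0"
  proof (rule fundamental_lemma_calculus_of_variations[OF \<open>open S\<close>])
    fix a b assume ab: "{a..b} \<subseteq> S"
    have "(\<lambda>x. 1) \<in> L2 {a..b}"
      by (simp add: L2_def integrable_const finite_measure_lebesgue_on)
    then have "integrable (lebesgue_on {a..b}) (\<lambda>x. (g x - h x) * 1)"
      by (intro integrable_L2_mult L2_mono[OF L2_diff[OF g(1) h(1)] ab S]) auto
    then show "integrable (lebesgue_on {a..b}) (\<lambda>x. g x - h x)" by simp
  next
    fix \<phi> assume \<phi>: "test_function S \<phi>"
    have "(\<integral>x. g x * \<phi> x - h x * \<phi> x \<partial>(lebesgue_on S))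
        = (\<integral>x. g x * \<phi> x \<partial>(lebesgue_on S)) - (\<integral>x. h x * \<phi> x \<partial>(lebesgue_on S))"
      by (intro Bochner_Integration.integral_diff integrable_L2_mult g h test_function_L2[OF \<phi> S])
    also have "\<dots> = 0"
      using g(2) h(2) \<phi> by (simp add: weak_derivative_def)
    finally show "(\<integral>x. (g x - h x) * \<phi> x \<partial>(lebesgue_on S)) = 0"
      by (simp add: algebra_simps)
  qed
  then show ?thesis by simp
qed

text \<open>By uniqueness, the weak derivative chosen in the definition of the norm may be replaced by the
  classical one.\<close>

lemma H1_if_classical:
  fixes F F' :: "real \<Rightarrow> complex"
  assumes "open S"
    and F: "\<And>x. (F has_vector_derivative F' x) (at x)" "continuous_on UNIV F'"
    and L2: "F \<in> L2 S" "F' \<in> L2 S" and f: "\<And>x. x \<in> S \<Longrightarrow> f x = F x"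
  shows "f \<in> H1 S" "H1_norm_sq S f = L2_norm_sq S F + L2_norm_sq S F'"
proof -
  have S: "S \<in> sets lebesgue" using \<open>open S\<close> by (simp add: borel_open)
  have wd: "weak_derivative S f F'"
    by (rule weak_derivative_if_classical[OF S F f]) auto
  show "f \<in> H1 S"
  proof -
    have "f \<in> L2 S" by (rule L2_cong[THEN iffD2, OF f L2(1)])
    then show ?thesis unfolding H1_def using L2(2) wd by blast
  qed
  let ?g = "SOME g. g \<in> L2 S \<and> weak_derivative S f g"
  have g: "?g \<in> L2 S" "weak_derivative S f ?g"
    using someI[of "\<lambda>g. g \<in> L2 S \<and> weak_derivative S f g" F', OF conjI[OF L2(2) wd]] by simp_all
  have "AE x in lebesgue_on S. ?g x = F' x"
    by (rule weak_derivative_unique[OF \<open>open S\<close> g L2(2) wd])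
  then have "L2_norm_sq S ?g = L2_norm_sq S F'"
    unfolding L2_norm_sq_def using g(1) L2(2)
    by (intro integral_cong_AE) (auto simp: L2_def elim!: eventually_mono)
  then show "H1_norm_sq S f = L2_norm_sq S F + L2_norm_sq S F'"
    unfolding H1_norm_sq_def using L2_norm_sq_cong[OF f] by simp
qed

section \<open>Solitons and their masses\<close>

lemma sech_pos: "sech x > 0"
  by (simp add: sech_def cosh_real_pos)

lemma sech_minus [simp]: "sech (- x) = sech x"
  by (simp add: sech_def)

lemma sech_square: "(sech x)\<^sup>2 = 1 - (tanh x)\<^sup>2"
proof -
  have "(sech x)\<^sup>2 = ((cosh x)\<^sup>2 - (sinh x)\<^sup>2) / (cosh x)\<^sup>2"
    by (simp add: sech_def hyperbolic_pythagoras power_divide)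
  then show ?thesis
    by (simp add: tanh_def power_divide diff_divide_distrib)
qed

lemma sech_has_derivative: "(sech has_real_derivative - sech x * tanh x) (at x)"
  unfolding sech_def [abs_def]
  by (auto intro!: derivative_eq_intros simp: tanh_def power2_eq_square)

lemma continuous_on_sech [continuous_intros]:
  "continuous_on A f \<Longrightarrow> continuous_on A (\<lambda>x. sech (f x))"
  unfolding sech_def by (intro continuous_intros) auto

lemma continuous_on_tanh_real [continuous_intros]:
  fixes f :: "_ \<Rightarrow> real"
  shows "continuous_on A f \<Longrightarrow> continuous_on A (\<lambda>x. tanh (f x))"
  by (intro continuous_intros) auto

lemma tendsto_sech [tendsto_intros]:
  "(f \<longlongrightarrow> a) F \<Longrightarrow> ((\<lambda>x. sech (f x)) \<longlongrightarrow> sech a) F"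
  unfolding sech_def by (intro tendsto_intros) auto

lemma sech_le_exp: "sech x \<le> 2 * exp (- \<bar>x\<bar>)"
proof -
  have "exp \<bar>x\<bar> / 2 \<le> cosh x" by (simp add: cosh_field_def abs_if)
  then have "sech x \<le> 1 / (exp \<bar>x\<bar> / 2)"
    unfolding sech_def by (intro divide_left_mono) (auto simp: cosh_real_pos)
  then show ?thesis by (simp add: exp_minus field_simps)
qed

lemma exp_le_sech: "exp (- \<bar>x\<bar>) \<le> sech x"
proof -
  have "cosh x \<le> exp \<bar>x\<bar>" by (simp add: cosh_field_def abs_if)
  then have "1 / exp \<bar>x\<bar> \<le> sech x"
    unfolding sech_def by (intro divide_left_mono) (auto simp: cosh_real_pos)
  then show ?thesis by (simp add: exp_minus divide_inverse)
qed

text \<open>A majorant of all solitons whose frequencies stay above \<open>c\<close> and whose phases stay bounded. It is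
  again a hyperbolic secant, so the integrability of \<open>sech\<^sup>2\<close> is the only one needed.\<close>

lemma sech_shift_bound:
  assumes "0 < c" "c \<le> s"
  shows "sech (s * x - a) \<le> 2 * exp \<bar>a\<bar> * sech (c * x)"
proof -
  have "c * \<bar>x\<bar> \<le> s * \<bar>x\<bar>" using assms by (intro mult_right_mono) auto
  also have "\<dots> = \<bar>s * x\<bar>" using assms by (simp add: abs_mult)
  finally have "- \<bar>s * x - a\<bar> \<le> \<bar>a\<bar> + - \<bar>c * x\<bar>"
    using assms by (simp add: abs_mult)
  then have "exp (- \<bar>s * x - a\<bar>) \<le> exp \<bar>a\<bar> * exp (- \<bar>c * x\<bar>)"
    by (simp flip: exp_add)
  also have "\<dots> \<le> exp \<bar>a\<bar> * sech (c * x)"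
    by (intro mult_left_mono exp_le_sech) simp
  finally show ?thesis
    using sech_le_exp[of "s * x - a"] by simp
qed

text \<open>A primitive of the integrand is \<open>tanh (s x - a) / s\<close>, with limit \<open>1/s\<close> at infinity and value
  \<open>- tanh a / s\<close> at \<open>0\<close>.\<close>

lemma sech_sq_integral_right:
  assumes "s > 0"
  shows "has_bochner_integral lebesgue (\<lambda>x. indicator {0<..} x * (sech (s * x - a))\<^sup>2) ((1 + tanh a) / s)"
proof -
  have lim: "((\<lambda>x. tanh (s * x - a) / s) \<longlongrightarrow> 1 / s) at_top"
  proof (rule tendsto_divide[OF filterlim_compose[OF tanh_real_at_top] tendsto_const])
    show "filterlim (\<lambda>x. s * x - a) at_top at_top"
      using assms by real_asymp
  qed (use assms in auto)
  have m: "(\<lambda>x. (sech (s * x - a))\<^sup>2) \<in> borel_measurable borel"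
    by (intro borel_measurable_continuous_onI continuous_intros)
  have "(\<integral>\<^sup>+x. ennreal ((sech (s * x - a))\<^sup>2) * indicator {0..} x \<partial>lborel)
      = 1 / s - tanh (s * 0 - a) / s"
    by (rule nn_integral_FTC_atLeast[OF m _ _ lim])
      (use assms in \<open>auto intro!: derivative_eq_intros simp flip: sech_square\<close>)
  also have "\<dots> = (1 + tanh a) / s" by (simp add: add_divide_distrib)
  finally have nn: "(\<integral>\<^sup>+x. ennreal ((sech (s * x - a))\<^sup>2) * indicator {0..} x \<partial>lborel) = (1 + tanh a) / s" .
  have e: "ennreal ((sech (s * x - a))\<^sup>2) * indicator {0..} x
      = ennreal (indicator {0..} x * (sech (s * x - a))\<^sup>2)" for x
    by (auto simp: indicator_def)
  have "has_bochner_integral lborel (\<lambda>x. indicator {0..} x * (sech (s * x - a))\<^sup>2) ((1 + tanh a) / s)"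
    by (rule has_bochner_integral_nn_integral)
      (use m nn assms tanh_real_gt_neg1[of a] in \<open>auto simp: e\<close>)
  then have "has_bochner_integral lborel (\<lambda>x. indicator {0<..} x * (sech (s * x - a))\<^sup>2) ((1 + tanh a) / s)"
    by (rule has_bochner_integral_cong_AE[THEN iffD1, rotated -1])
      (use AE_lborel_singleton[of "0::real"] m in \<open>auto simp: indicator_def elim!: eventually_mono\<close>)
  then show ?thesis
    using m by (simp add: has_bochner_integral_iff integrable_completion integral_completion)
qed

lemma sech_sq_integral_left:
  assumes "s > 0"
  shows "has_bochner_integral lebesgue (\<lambda>x. indicator {..<0} x * (sech (s * x - a))\<^sup>2) ((1 - tanh a) / s)"
proof -
  have m: "(\<lambda>x. (sech (s * x - a))\<^sup>2) \<in> borel_measurable borel" for a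
    by (intro borel_measurable_continuous_onI continuous_intros)
  have "has_bochner_integral lborel (\<lambda>x. indicator {0<..} x * (sech (s * x - (- a)))\<^sup>2) ((1 + tanh (- a)) / s)"
    using sech_sq_integral_right[OF assms, of "- a"] m[of "- a"]
    by (simp add: has_bochner_integral_iff integrable_completion integral_completion)
  then have "has_bochner_integral lborel (\<lambda>x. indicator {0<..} (0 + (-1) * x) * (sech (s * (0 + (-1) * x) - (- a)))\<^sup>2)
      (((1 + tanh (- a)) / s) /\<^sub>R \<bar>-1\<bar>)"
    by (subst (asm) lborel_has_bochner_integral_real_affine_iff[of "-1" _ _ 0]) auto
  moreover have "indicator {0<..} (0 + (-1) * x) * (sech (s * (0 + (-1) * x) - (- a)))\<^sup>2
      = indicator {..<0} x * (sech (s * x - a))\<^sup>2" for x :: real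
    using sech_minus[of "s * x - a"] by (simp add: indicator_def)
  ultimately have "has_bochner_integral lborel (\<lambda>x. indicator {..<0} x * (sech (s * x - a))\<^sup>2) ((1 - tanh a) / s)"
    by simp
  then show ?thesis
    using m by (simp add: has_bochner_integral_iff integrable_completion integral_completion)
qed

lemma integrable_sech_sq:
  assumes "s > 0"
  shows "integrable lebesgue (\<lambda>x. (sech (s * x - a))\<^sup>2)"
    "(\<integral>x. (sech (s * x - a))\<^sup>2 \<partial>lebesgue) = 2 / s"
proof -
  have m: "(\<lambda>x. (sech (s * x - a))\<^sup>2) \<in> borel_measurable lebesgue"
    by (intro continuous_imp_lebesgue_measurable continuous_intros)
  have "has_bochner_integral lebesgue
      (\<lambda>x. indicator {..<0} x * (sech (s * x - a))\<^sup>2 + indicator {0<..} x * (sech (s * x - a))\<^sup>2)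
      ((1 - tanh a) / s + (1 + tanh a) / s)"
    by (intro has_bochner_integral_add sech_sq_integral_left sech_sq_integral_right assms)
  moreover from this have "(\<lambda>x. indicator {..<0} x * (sech (s * x - a))\<^sup>2 + indicator {0<..} x * (sech (s * x - a))\<^sup>2)
      \<in> borel_measurable lebesgue"
    by (simp add: borel_measurable_integrable has_bochner_integral_iff)
  moreover have "AE x in lebesgue. indicator {..<0} x * (sech (s * x - a))\<^sup>2 + indicator {0<..} x * (sech (s * x - a))\<^sup>2
      = (sech (s * x - a))\<^sup>2"
    using AE_completion[OF AE_lborel_singleton[of "0::real"]]
    by eventually_elim (auto simp: indicator_def)
  ultimately have "has_bochner_integral lebesgue (\<lambda>x. (sech (s * x - a))\<^sup>2) ((1 - tanh a) / s + (1 + tanh a) / s)"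
    using m has_bochner_integral_cong_AE by blast
  then show "integrable lebesgue (\<lambda>x. (sech (s * x - a))\<^sup>2)"
    "(\<integral>x. (sech (s * x - a))\<^sup>2 \<partial>lebesgue) = 2 / s"
    by (simp_all add: has_bochner_integral_iff flip: add_divide_distrib)
qed

definition soliton :: "real \<Rightarrow> real \<Rightarrow> real \<Rightarrow> real \<Rightarrow> complex" where
  "soliton A s a x = complex_of_real (A * sech (s * x - a))"

definition soliton' :: "real \<Rightarrow> real \<Rightarrow> real \<Rightarrow> real \<Rightarrow> complex" where
  "soliton' A s a x = complex_of_real (- (A * s * (sech (s * x - a) * tanh (s * x - a))))"

definition two_solitons :: "real \<Rightarrow> real \<Rightarrow> real \<Rightarrow> real \<Rightarrow> real \<Rightarrow> real \<Rightarrow> complex" where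
  "two_solitons A a B b s x =
     (if x < 0 then soliton A s a x else if x > 0 then soliton B s b x else 0)"

lemma soliton_has_derivative: "(soliton A s a has_vector_derivative soliton' A s a x) (at x)"
proof -
  have "((\<lambda>x. s * x - a) has_real_derivative s) (at x)"
    by (auto intro!: derivative_eq_intros)
  then have "((\<lambda>x. A * sech (s * x - a)) has_real_derivative
      - (A * s * (sech (s * x - a) * tanh (s * x - a)))) (at x)"
    using DERIV_cmult[OF DERIV_chain2[OF sech_has_derivative], of "\<lambda>x. s * x - a" s x UNIV A]
    by (simp add: mult_ac)
  then show ?thesis
    unfolding soliton_def [abs_def] soliton'_def
    by (intro has_vector_derivative_of_real) (simp add: has_real_derivative_iff_has_vector_derivative)
qed

lemma continuous_soliton: "continuous_on UNIV (soliton A s a)" "continuous_on UNIV (soliton' A s a)"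
  unfolding soliton_def [abs_def] soliton'_def [abs_def]
  by (auto intro!: continuous_intros simp del: of_real_mult of_real_minus)

lemma soliton_bound:
  assumes "0 < c" "c \<le> s"
  shows "cmod (soliton A s a x) \<le> 2 * \<bar>A\<bar> * exp \<bar>a\<bar> * sech (c * x)"
    "cmod (soliton' A s a x) \<le> 2 * \<bar>A * s\<bar> * exp \<bar>a\<bar> * sech (c * x)"
proof -
  let ?y = "s * x - a"
  have "cmod (soliton A s a x) = \<bar>A\<bar> * sech ?y"
    using sech_pos[of ?y] by (simp add: soliton_def norm_mult abs_mult less_imp_le del: of_real_mult)
  also have "\<dots> \<le> \<bar>A\<bar> * (2 * exp \<bar>a\<bar> * sech (c * x))"
    by (intro mult_left_mono sech_shift_bound assms) simp
  finally show "cmod (soliton A s a x) \<le> 2 * \<bar>A\<bar> * exp \<bar>a\<bar> * sech (c * x)"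
    by (simp add: mult_ac)
  have "cmod (soliton' A s a x) = \<bar>A * s\<bar> * (sech ?y * \<bar>tanh ?y\<bar>)"
    using sech_pos[of ?y] by (simp add: soliton'_def norm_mult abs_mult less_imp_le del: of_real_mult)
  also have "\<dots> \<le> \<bar>A * s\<bar> * (sech ?y * 1)"
    using tanh_real_bounds[of ?y] sech_pos[of ?y] by (intro mult_left_mono) auto
  also have "\<dots> \<le> \<bar>A * s\<bar> * (2 * exp \<bar>a\<bar> * sech (c * x))"
    using sech_shift_bound[OF assms, of x a] by (intro mult_left_mono) auto
  finally show "cmod (soliton' A s a x) \<le> 2 * \<bar>A * s\<bar> * exp \<bar>a\<bar> * sech (c * x)"
    by (simp add: mult_ac)
qed

lemma L2_if_sech_bound:
  assumes f: "continuous_on UNIV f" and "c > 0" and bound: "\<And>x. cmod (f x) \<le> K * sech (c * x)"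
    and S: "S \<in> sets lebesgue"
  shows "f \<in> L2 S"
proof -
  have m: "f \<in> borel_measurable lebesgue"
    using f by (rule continuous_imp_lebesgue_measurable)
  have "integrable lebesgue (\<lambda>x. (cmod (f x))\<^sup>2)"
  proof (rule Bochner_Integration.integrable_bound)
    show "integrable lebesgue (\<lambda>x. K\<^sup>2 * (sech (c * x))\<^sup>2)"
      using integrable_sech_sq(1)[OF \<open>c > 0\<close>, of 0, unfolded diff_zero] by (rule Bochner_Integration.integrable_mult_right)
    show "AE x in lebesgue. norm ((cmod (f x))\<^sup>2) \<le> norm (K\<^sup>2 * (sech (c * x))\<^sup>2)"
      using power_mono[OF bound norm_ge_zero, of _ 2]
      by (intro AE_I2) (simp add: power_mult_distrib abs_mult)
  qed (use m in measurable)
  then have "f \<in> L2 UNIV" using m by (simp add: L2_def lebesgue_on_UNIV_eq)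
  then show ?thesis by (rule L2_mono) (use S in auto)
qed

lemma soliton_L2:
  assumes "s > 0" "S \<in> sets lebesgue"
  shows "soliton A s a \<in> L2 S" "soliton' A s a \<in> L2 S"
  using L2_if_sech_bound[OF continuous_soliton(1) assms(1) soliton_bound(1)[OF assms(1) order_refl] assms(2)]
    L2_if_sech_bound[OF continuous_soliton(2) assms(1) soliton_bound(2)[OF assms(1) order_refl] assms(2)]
  by auto

lemma L2_norm_sq_two_solitons:
  assumes "s > 0"
  shows "L2_norm_sq UNIV (two_solitons A a B b s) = (A\<^sup>2 * (1 - tanh a) + B\<^sup>2 * (1 + tanh b)) / s"
proof -
  have e: "(cmod (two_solitons A a B b s x))\<^sup>2 =
      A\<^sup>2 * (indicator {..<0} x * (sech (s * x - a))\<^sup>2) +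
      B\<^sup>2 * (indicator {0<..} x * (sech (s * x - b))\<^sup>2)" for x
    by (simp add: two_solitons_def soliton_def indicator_def norm_mult power_mult_distrib)
  have "has_bochner_integral lebesgue (\<lambda>x. (cmod (two_solitons A a B b s x))\<^sup>2)
      (A\<^sup>2 * ((1 - tanh a) / s) + B\<^sup>2 * ((1 + tanh b) / s))"
    unfolding e by (intro has_bochner_integral_add has_bochner_integral_mult_right
        sech_sq_integral_left sech_sq_integral_right assms)
  then show ?thesis
    by (simp add: L2_norm_sq_def lebesgue_on_UNIV_eq has_bochner_integral_iff flip: add_divide_distrib)
qed

section \<open>Convergence of solitons with convergent parameters\<close>

text \<open>Dominated convergence with majorant \<open>K\<^sup>2 sech\<^sup>2 (c x)\<close>, along sequences \<open>X n \<rightarrow> 0+\<close>. The bound holds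
  only eventually, hence the shift of the sequence by \<open>N\<close>.\<close>

lemma L2_norm_sq_tendsto_zero:
  fixes G :: "real \<Rightarrow> real \<Rightarrow> complex"
  assumes S: "S \<in> sets lebesgue" and "c > 0"
    and cont: "\<And>\<gamma>. continuous_on UNIV (G \<gamma>)"
    and bound: "\<forall>\<^sub>F \<gamma> in at_right 0. \<forall>x. cmod (G \<gamma> x) \<le> K * sech (c * x)"
    and lim: "\<And>x. ((\<lambda>\<gamma>. G \<gamma> x) \<longlongrightarrow> 0) (at_right 0)"
  shows "((\<lambda>\<gamma>. L2_norm_sq S (G \<gamma>)) \<longlongrightarrow> 0) (at_right 0)"
  unfolding tendsto_at_iff_sequentially
proof (intro allI impI)
  fix X :: "nat \<Rightarrow> real"
  assume X: "\<forall>i. X i \<in> {0<..} - {0}" "X \<longlonglongrightarrow> 0"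
  have X0: "filterlim X (at_right 0) sequentially"
    using X by (simp add: filterlim_at less_imp_neq[THEN not_sym])
  from eventually_compose_filterlim[OF bound X0]
  obtain N where N: "\<And>n x. n \<ge> N \<Longrightarrow> cmod (G (X n) x) \<le> K * sech (c * x)"
    unfolding eventually_sequentially by blast
  let ?H = "\<lambda>n x. indicat_real S x *\<^sub>R (cmod (G (X (n + N)) x))\<^sup>2"
  have "(\<lambda>n. \<integral>x. ?H n x \<partial>lebesgue) \<longlonglongrightarrow> (\<integral>x. 0 \<partial>(lebesgue :: real measure))"
  proof (rule integral_dominated_convergence)
    show "integrable lebesgue (\<lambda>x. K\<^sup>2 * (sech (c * x))\<^sup>2)"
      using integrable_sech_sq(1)[OF \<open>c > 0\<close>, of 0, unfolded diff_zero] by (rule Bochner_Integration.integrable_mult_right)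
    show "?H n \<in> borel_measurable lebesgue" for n
      using S by (intro borel_measurable_scaleR borel_measurable_indicator
          continuous_imp_lebesgue_measurable continuous_intros cont) auto
    show "AE x in lebesgue. (\<lambda>n. ?H n x) \<longlonglongrightarrow> 0"
    proof (intro AE_I2)
      fix x
      have "(\<lambda>n. G (X n) x) \<longlonglongrightarrow> 0"
        by (rule filterlim_compose[OF lim X0])
      then have "(\<lambda>n. G (X (n + N)) x) \<longlonglongrightarrow> 0"
        by (rule LIMSEQ_ignore_initial_segment)
      then have "(\<lambda>n. ?H n x) \<longlonglongrightarrow> indicat_real S x *\<^sub>R (cmod 0)\<^sup>2"
        by (intro tendsto_intros)
      then show "(\<lambda>n. ?H n x) \<longlonglongrightarrow> 0" by simp
    qed
    show "AE x in lebesgue. norm (?H n x) \<le> K\<^sup>2 * (sech (c * x))\<^sup>2" for n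
    proof (intro AE_I2)
      fix x
      have "(cmod (G (X (n + N)) x))\<^sup>2 \<le> (K * sech (c * x))\<^sup>2"
        by (intro power_mono N) auto
      then show "norm (?H n x) \<le> K\<^sup>2 * (sech (c * x))\<^sup>2"
        by (simp add: indicator_def power_mult_distrib)
    qed
  qed simp
  then have "(\<lambda>n. L2_norm_sq S (G (X (n + N)))) \<longlonglongrightarrow> 0"
    using S by (simp add: L2_norm_sq_def integral_restrict_space)
  then show "((\<lambda>\<gamma>. L2_norm_sq S (G \<gamma>)) \<circ> X) \<longlonglongrightarrow> 0"
    unfolding comp_def by (rule LIMSEQ_offset)
qed

text \<open>The frequencies are eventually larger than half of their positive limit, which yields a majorant
  independent of \<open>\<gamma>\<close>.\<close>

lemma soliton_L2_convergence:
  fixes A s a :: "real \<Rightarrow> real"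
  assumes S: "S \<in> sets lebesgue" and "s0 > 0"
    and A: "(A \<longlongrightarrow> A0) (at_right 0)" and s: "(s \<longlongrightarrow> s0) (at_right 0)"
    and a: "(a \<longlongrightarrow> a0) (at_right 0)"
  shows "((\<lambda>\<gamma>. L2_norm_sq S (\<lambda>x. soliton (A \<gamma>) (s \<gamma>) (a \<gamma>) x - soliton A0 s0 a0 x)) \<longlongrightarrow> 0) (at_right 0)"
    "((\<lambda>\<gamma>. L2_norm_sq S (\<lambda>x. soliton' (A \<gamma>) (s \<gamma>) (a \<gamma>) x - soliton' A0 s0 a0 x)) \<longlongrightarrow> 0) (at_right 0)"
proof -
  define c where "c = s0 / 2"
  have c: "c > 0" "c \<le> s0" using \<open>s0 > 0\<close> by (auto simp: c_def)
  have ev: "\<forall>\<^sub>F \<gamma> in at_right 0. c < s \<gamma> \<and>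
      2 * \<bar>A \<gamma>\<bar> * exp \<bar>a \<gamma>\<bar> < 2 * \<bar>A0\<bar> * exp \<bar>a0\<bar> + 1 \<and>
      2 * \<bar>A \<gamma> * s \<gamma>\<bar> * exp \<bar>a \<gamma>\<bar> < 2 * \<bar>A0 * s0\<bar> * exp \<bar>a0\<bar> + 1"
  proof (intro eventually_conj)
    show "\<forall>\<^sub>F \<gamma> in at_right 0. c < s \<gamma>"
      by (rule order_tendstoD(1)[OF s]) (use \<open>s0 > 0\<close> in \<open>simp add: c_def\<close>)
    have "((\<lambda>\<gamma>. 2 * \<bar>A \<gamma>\<bar> * exp \<bar>a \<gamma>\<bar>) \<longlongrightarrow> 2 * \<bar>A0\<bar> * exp \<bar>a0\<bar>) (at_right 0)"
      by (intro tendsto_intros A a)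
    then show "\<forall>\<^sub>F \<gamma> in at_right 0. 2 * \<bar>A \<gamma>\<bar> * exp \<bar>a \<gamma>\<bar> < 2 * \<bar>A0\<bar> * exp \<bar>a0\<bar> + 1"
      by (rule order_tendstoD(2)) simp
    have "((\<lambda>\<gamma>. 2 * \<bar>A \<gamma> * s \<gamma>\<bar> * exp \<bar>a \<gamma>\<bar>) \<longlongrightarrow> 2 * \<bar>A0 * s0\<bar> * exp \<bar>a0\<bar>) (at_right 0)"
      by (intro tendsto_intros A a s)
    then show "\<forall>\<^sub>F \<gamma> in at_right 0. 2 * \<bar>A \<gamma> * s \<gamma>\<bar> * exp \<bar>a \<gamma>\<bar> < 2 * \<bar>A0 * s0\<bar> * exp \<bar>a0\<bar> + 1"
      by (rule order_tendstoD(2)) simp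
  qed
  have bound: "cmod (u - v) \<le> (M + 1 + M) * sech (c * x)"
    if "cmod u \<le> L * sech (c * x)" "L < M + 1" "cmod v \<le> M * sech (c * x)" for u v L M x
  proof -
    have "L * sech (c * x) \<le> (M + 1) * sech (c * x)"
      using that(2) sech_pos[of "c * x"] by (intro mult_right_mono) auto
    then show ?thesis
      using norm_triangle_ineq4[of u v] that by (simp add: distrib_right)
  qed
  have lin: "((\<lambda>\<gamma>. s \<gamma> * x - a \<gamma>) \<longlongrightarrow> s0 * x - a0) (at_right 0)" for x
    by (intro tendsto_intros s a)
  show "((\<lambda>\<gamma>. L2_norm_sq S (\<lambda>x. soliton (A \<gamma>) (s \<gamma>) (a \<gamma>) x - soliton A0 s0 a0 x)) \<longlongrightarrow> 0) (at_right 0)"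
  proof (rule L2_norm_sq_tendsto_zero[OF S c(1)])
    show "continuous_on UNIV (\<lambda>x. soliton (A \<gamma>) (s \<gamma>) (a \<gamma>) x - soliton A0 s0 a0 x)" for \<gamma>
      by (intro continuous_on_diff continuous_soliton)
    show "\<forall>\<^sub>F \<gamma> in at_right 0. \<forall>x. cmod (soliton (A \<gamma>) (s \<gamma>) (a \<gamma>) x - soliton A0 s0 a0 x)
        \<le> (2 * \<bar>A0\<bar> * exp \<bar>a0\<bar> + 1 + 2 * \<bar>A0\<bar> * exp \<bar>a0\<bar>) * sech (c * x)"
      using ev
    proof eventually_elim
      case (elim \<gamma>)
      then show ?case
        using bound[OF soliton_bound(1)[OF c(1)] _ soliton_bound(1)[OF c]] by (simp add: less_imp_le)
    qed
    have "((\<lambda>\<gamma>. soliton (A \<gamma>) (s \<gamma>) (a \<gamma>) x) \<longlongrightarrow> soliton A0 s0 a0 x) (at_right 0)" for x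
      unfolding soliton_def by (intro tendsto_intros A tendsto_sech[OF lin])
    then show "((\<lambda>\<gamma>. soliton (A \<gamma>) (s \<gamma>) (a \<gamma>) x - soliton A0 s0 a0 x) \<longlongrightarrow> 0) (at_right 0)" for x
      by (rule LIM_zero)
  qed
  show "((\<lambda>\<gamma>. L2_norm_sq S (\<lambda>x. soliton' (A \<gamma>) (s \<gamma>) (a \<gamma>) x - soliton' A0 s0 a0 x)) \<longlongrightarrow> 0) (at_right 0)"
  proof (rule L2_norm_sq_tendsto_zero[OF S c(1)])
    show "continuous_on UNIV (\<lambda>x. soliton' (A \<gamma>) (s \<gamma>) (a \<gamma>) x - soliton' A0 s0 a0 x)" for \<gamma>
      by (intro continuous_on_diff continuous_soliton)
    show "\<forall>\<^sub>F \<gamma> in at_right 0. \<forall>x. cmod (soliton' (A \<gamma>) (s \<gamma>) (a \<gamma>) x - soliton' A0 s0 a0 x)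
        \<le> (2 * \<bar>A0 * s0\<bar> * exp \<bar>a0\<bar> + 1 + 2 * \<bar>A0 * s0\<bar> * exp \<bar>a0\<bar>) * sech (c * x)"
      using ev
    proof eventually_elim
      case (elim \<gamma>)
      then show ?case
        using bound[OF soliton_bound(2)[OF c(1)] _ soliton_bound(2)[OF c]] by (simp add: less_imp_le)
    qed
    have "((\<lambda>\<gamma>. soliton' (A \<gamma>) (s \<gamma>) (a \<gamma>) x) \<longlongrightarrow> soliton' A0 s0 a0 x) (at_right 0)" for x
      unfolding soliton'_def
      by (intro tendsto_intros A s tendsto_sech[OF lin] tendsto_tanh[OF lin]) simp
    then show "((\<lambda>\<gamma>. soliton' (A \<gamma>) (s \<gamma>) (a \<gamma>) x - soliton' A0 s0 a0 x) \<longlongrightarrow> 0) (at_right 0)" for x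
      by (rule LIM_zero)
  qed
qed

lemma soliton_H1_convergence:
  fixes A s a :: "real \<Rightarrow> real"
  assumes S: "open S" and "s0 > 0"
    and A: "(A \<longlongrightarrow> A0) (at_right 0)" and s: "(s \<longlongrightarrow> s0) (at_right 0)"
    and a: "(a \<longlongrightarrow> a0) (at_right 0)"
    and f: "\<And>\<gamma> x. x \<in> S \<Longrightarrow> f \<gamma> x = soliton (A \<gamma>) (s \<gamma>) (a \<gamma>) x"
  shows "soliton A0 s0 a0 \<in> H1 S" "\<forall>\<^sub>F \<gamma> in at_right 0. f \<gamma> \<in> H1 S"
    "((\<lambda>\<gamma>. H1_norm_sq S (\<lambda>x. f \<gamma> x - soliton A0 s0 a0 x)) \<longlongrightarrow> 0) (at_right 0)"
proof -
  have S': "S \<in> sets lebesgue" using \<open>open S\<close> by (simp add: borel_open)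
  have pos: "\<forall>\<^sub>F \<gamma> in at_right 0. s \<gamma> > 0"
    by (rule order_tendstoD(1)[OF s \<open>s0 > 0\<close>])
  show "soliton A0 s0 a0 \<in> H1 S"
    by (rule H1_if_classical(1)[OF S soliton_has_derivative continuous_soliton(2)
          soliton_L2[OF \<open>s0 > 0\<close> S']]) simp
  show "\<forall>\<^sub>F \<gamma> in at_right 0. f \<gamma> \<in> H1 S"
    using pos
  proof eventually_elim
    case (elim \<gamma>)
    show ?case
      by (rule H1_if_classical(1)[OF S soliton_has_derivative continuous_soliton(2)
            soliton_L2[OF elim S'] f])
  qed
  have "\<forall>\<^sub>F \<gamma> in at_right 0.
      L2_norm_sq S (\<lambda>x. soliton (A \<gamma>) (s \<gamma>) (a \<gamma>) x - soliton A0 s0 a0 x) +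
      L2_norm_sq S (\<lambda>x. soliton' (A \<gamma>) (s \<gamma>) (a \<gamma>) x - soliton' A0 s0 a0 x) =
      H1_norm_sq S (\<lambda>x. f \<gamma> x - soliton A0 s0 a0 x)"
    using pos
  proof eventually_elim
    case (elim \<gamma>)
    show ?case
    proof (rule H1_if_classical(2)[OF S, symmetric])
      show "((\<lambda>x. soliton (A \<gamma>) (s \<gamma>) (a \<gamma>) x - soliton A0 s0 a0 x) has_vector_derivative
          soliton' (A \<gamma>) (s \<gamma>) (a \<gamma>) x - soliton' A0 s0 a0 x) (at x)" for x
        by (rule has_vector_derivative_diff[OF soliton_has_derivative soliton_has_derivative])
      show "continuous_on UNIV (\<lambda>x. soliton' (A \<gamma>) (s \<gamma>) (a \<gamma>) x - soliton' A0 s0 a0 x)"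
        by (intro continuous_on_diff continuous_soliton)
    qed (use f in \<open>auto intro!: L2_diff soliton_L2 elim S' \<open>s0 > 0\<close>\<close>)
  qed
  moreover have "((\<lambda>\<gamma>. L2_norm_sq S (\<lambda>x. soliton (A \<gamma>) (s \<gamma>) (a \<gamma>) x - soliton A0 s0 a0 x) +
      L2_norm_sq S (\<lambda>x. soliton' (A \<gamma>) (s \<gamma>) (a \<gamma>) x - soliton' A0 s0 a0 x)) \<longlongrightarrow> 0 + 0) (at_right 0)"
    by (intro tendsto_add soliton_L2_convergence assms S')
  ultimately show "((\<lambda>\<gamma>. H1_norm_sq S (\<lambda>x. f \<gamma> x - soliton A0 s0 a0 x)) \<longlongrightarrow> 0) (at_right 0)"
    using Lim_transform_eventually by force
qed

lemma tendsto_Q_cong: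
  assumes "tendsto_Q f l F" "\<forall>\<^sub>F t in F. f t = g t"
  shows "tendsto_Q g l F"
proof -
  have "((\<lambda>t. Q_norm (\<lambda>x. g t x - l x)) \<longlongrightarrow> 0) F"
  proof (rule Lim_transform_eventually)
    show "\<forall>\<^sub>F t in F. Q_norm (\<lambda>x. f t x - l x) = Q_norm (\<lambda>x. g t x - l x)"
      using assms(2) by eventually_elim simp
  qed (use assms(1) in \<open>simp add: tendsto_Q_def\<close>)
  moreover have "\<forall>\<^sub>F t in F. f t \<in> Q" using assms(1) by (simp add: tendsto_Q_def)
  then have "\<forall>\<^sub>F t in F. g t \<in> Q" using assms(2) by eventually_elim simp
  ultimately show ?thesis using assms(1) by (simp add: tendsto_Q_def)
qed

text \<open>Both phases must have the same limit: only then is the limit a single soliton on the whole line.\<close>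

lemma two_solitons_tendsto_Q:
  fixes A s a b :: "real \<Rightarrow> real"
  assumes "s0 > 0"
    and A: "(A \<longlongrightarrow> A0) (at_right 0)" and s: "(s \<longlongrightarrow> s0) (at_right 0)"
    and a: "(a \<longlongrightarrow> a0) (at_right 0)" and b: "(b \<longlongrightarrow> a0) (at_right 0)"
  shows "tendsto_Q (\<lambda>\<gamma>. two_solitons (A \<gamma>) (a \<gamma>) (A \<gamma>) (b \<gamma>) (s \<gamma>)) (soliton A0 s0 a0) (at_right 0)"
proof -
  let ?f = "\<lambda>\<gamma>. two_solitons (A \<gamma>) (a \<gamma>) (A \<gamma>) (b \<gamma>) (s \<gamma>)"
  have R: "soliton A0 s0 a0 \<in> H1 {0<..}" "\<forall>\<^sub>F \<gamma> in at_right 0. ?f \<gamma> \<in> H1 {0<..}"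
    "((\<lambda>\<gamma>. H1_norm_sq {0<..} (\<lambda>x. ?f \<gamma> x - soliton A0 s0 a0 x)) \<longlongrightarrow> 0) (at_right 0)"
    by (rule soliton_H1_convergence[OF _ \<open>s0 > 0\<close> A s b]; simp add: two_solitons_def)+
  have L: "soliton A0 s0 a0 \<in> H1 {..<0}" "\<forall>\<^sub>F \<gamma> in at_right 0. ?f \<gamma> \<in> H1 {..<0}"
    "((\<lambda>\<gamma>. H1_norm_sq {..<0} (\<lambda>x. ?f \<gamma> x - soliton A0 s0 a0 x)) \<longlongrightarrow> 0) (at_right 0)"
    by (rule soliton_H1_convergence[OF _ \<open>s0 > 0\<close> A s a]; simp add: two_solitons_def)+
  have "((\<lambda>\<gamma>. Q_norm (\<lambda>x. ?f \<gamma> x - soliton A0 s0 a0 x)) \<longlongrightarrow> sqrt (0 + 0)) (at_right 0)"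
    unfolding Q_norm_def by (intro tendsto_intros R L)
  moreover have "\<forall>\<^sub>F \<gamma> in at_right 0. ?f \<gamma> \<in> Q"
    using R(2) L(2) by eventually_elim (simp add: Q_def)
  ultimately show ?thesis
    using R(1) L(1) by (simp add: tendsto_Q_def Q_def)
qed

section \<open>The symmetric family\<close>

lemma tanh_artanh_real:
  fixes t :: real
  assumes "\<bar>t\<bar> < 1"
  shows "tanh (artanh t) = t"
proof -
  have "exp (- 2 * artanh t) = inverse ((1 + t) / (1 - t))"
    using assms by (simp add: artanh_def exp_minus abs_less_iff)
  then have "tanh (artanh t) = (1 - (1 - t) / (1 + t)) / (1 + (1 - t) / (1 + t))"
    by (simp add: tanh_real_altdef)
  also have "\<dots> = t"
    using assms by (simp add: field_simps abs_less_iff)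
  finally show ?thesis .
qed

lemma sqrt_times_shift: "\<omega> > 0 \<Longrightarrow> sqrt \<omega> * shift \<omega> t = artanh t"
  by (simp add: shift_def artanh_def)

text \<open>These are \<open>\<surd>\<omega> x\<^sub>1\<close> and \<open>\<surd>\<omega> x\<^sub>2\<close>, in the form in which their hyperbolic tangents can be read off.\<close>

definition phase_left :: "sign \<Rightarrow> real \<Rightarrow> real \<Rightarrow> real" where
  "phase_left s \<gamma> \<omega> = (case s of Plus \<Rightarrow> artanh (t1 \<gamma> \<omega>) | Minus \<Rightarrow> - artanh (t2 \<gamma> \<omega>))"

definition phase_right :: "sign \<Rightarrow> real \<Rightarrow> real \<Rightarrow> real" where
  "phase_right s \<gamma> \<omega> = (case s of Plus \<Rightarrow> artanh (t2 \<gamma> \<omega>) | Minus \<Rightarrow> - artanh (t1 \<gamma> \<omega>))"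

lemma psi_plus_eq_two_solitons:
  assumes "\<omega> > 0"
  shows "psi_plus s lam \<gamma> \<omega> = two_solitons (sqrt (2 * \<omega> / lam)) (phase_left s \<gamma> \<omega>)
           (sqrt (2 * \<omega> / lam)) (phase_right s \<gamma> \<omega>) (sqrt \<omega>)"
proof -
  have "sqrt \<omega> * x1 s \<gamma> \<omega> = phase_left s \<gamma> \<omega>" "sqrt \<omega> * x2 s \<gamma> \<omega> = phase_right s \<gamma> \<omega>"
    by (cases s; simp add: phase_left_def phase_right_def sqrt_times_shift[OF assms])+
  then show ?thesis
    by (intro ext) (simp add: psi_plus_def two_solitons_def soliton_def right_diff_distrib)
qed

lemma psi_minus_eq_two_solitons:
  assumes "\<gamma> > 0" "\<omega> > 0"
  shows "psi_minus lam \<gamma> \<omega> = two_solitons (- sqrt (2 * \<omega> / lam)) (artanh (2 / (\<gamma> * sqrt \<omega>)))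
           (sqrt (2 * \<omega> / lam)) (- artanh (2 / (\<gamma> * sqrt \<omega>))) (sqrt \<omega>)"
proof -
  define u where "u = \<gamma> * sqrt \<omega>"
  have "u \<noteq> 0" using assms by (simp add: u_def)
  then have "1 + 2 / u = (u + 2) / u" "1 - 2 / u = (u - 2) / u"
    by (simp_all add: field_simps)
  then have "(1 + 2 / u) / (1 - 2 / u) = (u + 2) / (u - 2)"
    using \<open>u \<noteq> 0\<close> by simp
  then have "xbar \<gamma> \<omega> = shift \<omega> (2 / (\<gamma> * sqrt \<omega>))"
    by (simp add: xbar_def shift_def flip: u_def)
  then have "sqrt \<omega> * xbar \<gamma> \<omega> = artanh (2 / (\<gamma> * sqrt \<omega>))"
    by (simp add: sqrt_times_shift[OF assms(2)])
  then show ?thesis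
    by (intro ext) (simp add: psi_minus_def two_solitons_def soliton_def right_diff_distrib distrib_left)
qed

text \<open>With \<open>u = \<gamma> \<surd>\<omega>\<close> and \<open>S = \<surd>(1 + u\<^sup>2)\<close> the inner root \<open>R\<close> satisfies \<open>R\<^sup>2 = (S - 1) (S + 3)\<close>. The bounds on
  \<open>t\<^sub>1\<close> and \<open>t\<^sub>2\<close> then amount to \<open>S - 1 < R < 2 u - (S - 1)\<close>, and both inequalities follow by
  squaring, the second because \<open>(2 u - (S - 1))\<^sup>2 - R\<^sup>2 = 4 (S - 1) (S - u) > 0\<close>.\<close>

lemma t_bounds:
  assumes "\<gamma> > 0" "\<omega> > 0"
  shows "\<bar>t1 \<gamma> \<omega>\<bar> < 1" "\<bar>t2 \<gamma> \<omega>\<bar> < 1"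
    "t2 \<gamma> \<omega> - t1 \<gamma> \<omega> = (sqrt (1 + \<gamma>\<^sup>2 * \<omega>) - 1) / (\<gamma> * sqrt \<omega>)"
proof -
  define u where "u = \<gamma> * sqrt \<omega>"
  define S where "S = sqrt (1 + \<gamma>\<^sup>2 * \<omega>)"
  define R where "R = sqrt (\<gamma>\<^sup>2 * \<omega> - 2 + 2 * S)"
  have u: "u > 0" "u\<^sup>2 = \<gamma>\<^sup>2 * \<omega>"
    using assms by (simp_all add: u_def power_mult_distrib)
  have S2: "S\<^sup>2 = 1 + u\<^sup>2"
    using assms by (simp add: S_def u(2))
  have S1: "S > 1" using assms by (simp add: S_def)
  have Su: "S > u" by (rule power2_less_imp_less) (use S1 S2 in auto)
  have uS: "S < u + 1"
    by (rule power2_less_imp_less) (use u(1) S2 in \<open>auto simp: power2_sum\<close>)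
  have "\<gamma>\<^sup>2 * \<omega> - 2 + 2 * S = (S - 1) * (S + 3)"
    using S2 unfolding u(2) by (simp add: algebra_simps power2_eq_square)
  then have R: "R = sqrt ((S - 1) * (S + 3))"
    by (simp add: R_def)
  have R2: "R\<^sup>2 = (S - 1) * (S + 3)" and R0: "R \<ge> 0"
    unfolding R using S1 by simp_all
  have "(S - 1)\<^sup>2 < R\<^sup>2"
    using S1 unfolding R2 by (simp add: power2_eq_square)
  then have RS: "S - 1 < R" by (rule power2_less_imp_less) (rule R0)
  have "(2 * u - (S - 1))\<^sup>2 - R\<^sup>2 = 4 * (S - 1) * (S - u)"
    using S2 unfolding R2 by (simp add: algebra_simps power2_eq_square)
  moreover have "4 * (S - 1) * (S - u) > 0" using S1 Su by simp
  ultimately have "R\<^sup>2 < (2 * u - (S - 1))\<^sup>2" by simp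
  then have RU: "R < 2 * u - (S - 1)"
    by (rule power2_less_imp_less) (use uS u(1) in simp)
  have t: "t1 \<gamma> \<omega> = (1 - S + R) / (2 * u)" "t2 \<gamma> \<omega> = (- 1 + S + R) / (2 * u)"
    by (simp_all add: t1_def t2_def S_def R_def u_def mult.assoc)
  show "\<bar>t1 \<gamma> \<omega>\<bar> < 1" "\<bar>t2 \<gamma> \<omega>\<bar> < 1"
    unfolding t using RS RU S1 u(1) by (simp_all add: abs_less_iff field_simps)
  have "t2 \<gamma> \<omega> - t1 \<gamma> \<omega> = (S - 1) / u"
    unfolding t using u(1) by (simp add: field_simps)
  then show "t2 \<gamma> \<omega> - t1 \<gamma> \<omega> = (sqrt (1 + \<gamma>\<^sup>2 * \<omega>) - 1) / (\<gamma> * sqrt \<omega>)"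
    by (simp add: S_def u_def)
qed

definition mass_plus :: "real \<Rightarrow> real \<Rightarrow> real \<Rightarrow> real" where
  "mass_plus lam \<gamma> \<omega> = 2 / lam * (2 * sqrt \<omega> + (sqrt (1 + \<gamma>\<^sup>2 * \<omega>) - 1) / \<gamma>)"

text \<open>For both signs the hyperbolic tangents of the phases contribute \<open>2 + (t\<^sub>2 - t\<^sub>1)\<close>, because exchanging
  the sign only swaps and negates the two phases.\<close>

lemma L2_norm_sq_psi_plus:
  assumes "lam > 0" "\<gamma> > 0" "\<omega> > 0"
  shows "L2_norm_sq UNIV (psi_plus s lam \<gamma> \<omega>) = mass_plus lam \<gamma> \<omega>"
proof -
  note tb = t_bounds[OF assms(2,3)]
  have "(1 - tanh (phase_left s \<gamma> \<omega>)) + (1 + tanh (phase_right s \<gamma> \<omega>)) = 2 + (t2 \<gamma> \<omega> - t1 \<gamma> \<omega>)"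
    using tb(1,2) by (cases s) (simp_all add: phase_left_def phase_right_def tanh_artanh_real)
  also have "\<dots> = 2 + (sqrt (1 + \<gamma>\<^sup>2 * \<omega>) - 1) / (\<gamma> * sqrt \<omega>)"
    by (simp only: tb(3))
  finally have *: "(1 - tanh (phase_left s \<gamma> \<omega>)) + (1 + tanh (phase_right s \<gamma> \<omega>)) =
      2 + (sqrt (1 + \<gamma>\<^sup>2 * \<omega>) - 1) / (\<gamma> * sqrt \<omega>)" .
  have "L2_norm_sq UNIV (psi_plus s lam \<gamma> \<omega>) =
      (2 * \<omega> / lam) * ((1 - tanh (phase_left s \<gamma> \<omega>)) + (1 + tanh (phase_right s \<gamma> \<omega>))) / sqrt \<omega>"
  proof -
    have "(sqrt (2 * \<omega> / lam))\<^sup>2 = 2 * \<omega> / lam" "sqrt \<omega> > 0" using assms by simp_all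
    then show ?thesis
      by (simp only: psi_plus_eq_two_solitons[OF assms(3)] L2_norm_sq_two_solitons distrib_left)
  qed
  also have "\<dots> = (2 * (sqrt \<omega> * sqrt \<omega>) / lam) * (2 + (sqrt (1 + \<gamma>\<^sup>2 * \<omega>) - 1) / (\<gamma> * sqrt \<omega>)) / sqrt \<omega>"
    unfolding * using assms(3) by simp
  also have "\<dots> = mass_plus lam \<gamma> \<omega>"
    unfolding mass_plus_def using assms
    by (simp add: field_simps del: real_sqrt_mult_self)
  finally show ?thesis .
qed

lemma mass_plus_strict_mono:
  assumes "lam > 0" "\<gamma> > 0" "0 \<le> \<omega>" "\<omega> < \<omega>'"
  shows "mass_plus lam \<gamma> \<omega> < mass_plus lam \<gamma> \<omega>'"
proof -
  have "sqrt \<omega> < sqrt \<omega>'" using assms by simp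
  moreover have "(sqrt (1 + \<gamma>\<^sup>2 * \<omega>) - 1) / \<gamma> \<le> (sqrt (1 + \<gamma>\<^sup>2 * \<omega>') - 1) / \<gamma>"
    using assms by (intro divide_right_mono) auto
  ultimately show ?thesis
    unfolding mass_plus_def using assms(1) by (intro mult_strict_left_mono add_less_le_mono) auto
qed

text \<open>The intermediate value theorem on \<open>[0, (\<lambda>\<rho>/4)\<^sup>2]\<close>. The lower bound on the frequency comes from
  \<open>(\<surd>(1 + \<gamma>\<^sup>2 \<omega>) - 1) / \<gamma> \<le> \<gamma> \<omega> / 2\<close>.\<close>

lemma mass_plus_attains:
  assumes "lam > 0" "\<gamma> > 0" "\<rho> > 0"
  obtains \<omega> where "\<omega> > 0" "mass_plus lam \<gamma> \<omega> = \<rho>"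
    "lam * \<rho> / 4 - \<gamma> * (lam * \<rho> / 4)\<^sup>2 / 4 \<le> sqrt \<omega>" "sqrt \<omega> \<le> lam * \<rho> / 4"
proof -
  let ?m = "lam * \<rho> / 4"
  have m: "?m > 0" using assms by simp
  have "\<exists>\<omega>. 0 \<le> \<omega> \<and> \<omega> \<le> ?m\<^sup>2 \<and> mass_plus lam \<gamma> \<omega> = \<rho>"
  proof (rule IVT')
    show "mass_plus lam \<gamma> 0 \<le> \<rho>" using assms by (simp add: mass_plus_def)
    have "\<rho> = 2 / lam * (2 * sqrt (?m\<^sup>2) + 0)"
      using assms m by (simp add: real_sqrt_abs)
    also have "\<dots> \<le> mass_plus lam \<gamma> (?m\<^sup>2)"
      unfolding mass_plus_def using assms by (intro mult_left_mono add_left_mono) auto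
    finally show "\<rho> \<le> mass_plus lam \<gamma> (?m\<^sup>2)" .
    show "continuous_on {0..?m\<^sup>2} (mass_plus lam \<gamma>)"
      unfolding mass_plus_def [abs_def] using assms by (intro continuous_intros) auto
  qed simp
  then obtain \<omega> where w: "0 \<le> \<omega>" "\<omega> \<le> ?m\<^sup>2" "mass_plus lam \<gamma> \<omega> = \<rho>" by blast
  have "\<omega> \<noteq> 0" using w(3) assms by (auto simp: mass_plus_def)
  then have "\<omega> > 0" using w(1) by simp
  have le: "sqrt \<omega> \<le> ?m" using real_sqrt_le_mono[OF w(2)] m by simp
  have "sqrt (1 + \<gamma>\<^sup>2 * \<omega>) \<le> 1 + \<gamma>\<^sup>2 * \<omega> / 2"
    by (rule real_le_lsqrt) (use w(1) in \<open>auto simp: power2_sum\<close>)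
  then have "(sqrt (1 + \<gamma>\<^sup>2 * \<omega>) - 1) / \<gamma> \<le> (\<gamma>\<^sup>2 * \<omega> / 2) / \<gamma>"
    using assms by (intro divide_right_mono) auto
  also have "\<dots> = \<gamma> * \<omega> / 2" using assms by (simp add: power2_eq_square)
  also have "\<dots> \<le> \<gamma> * ?m\<^sup>2 / 2" using assms w(2) by (intro divide_right_mono mult_left_mono) auto
  finally have "(sqrt (1 + \<gamma>\<^sup>2 * \<omega>) - 1) / \<gamma> \<le> \<gamma> * ?m\<^sup>2 / 2" .
  moreover have "2 * sqrt \<omega> + (sqrt (1 + \<gamma>\<^sup>2 * \<omega>) - 1) / \<gamma> = lam * \<rho> / 2"
    using w(3) assms unfolding mass_plus_def by (simp add: field_simps)
  ultimately have "?m - \<gamma> * ?m\<^sup>2 / 4 \<le> sqrt \<omega>" by linarith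
  with \<open>\<omega> > 0\<close> w(3) le that show ?thesis by blast
qed

lemma member_of_mass_eq:
  assumes "\<omega> \<in> W" "L2_norm_sq UNIV (\<psi> \<omega>) = \<rho>"
    and "\<And>\<omega>'. \<omega>' \<in> W \<Longrightarrow> L2_norm_sq UNIV (\<psi> \<omega>') = \<rho> \<Longrightarrow> \<omega>' = \<omega>"
  shows "member_of_mass W \<psi> \<rho> = \<psi> \<omega>"
proof -
  have "(THE \<omega>. \<omega> \<in> W \<and> L2_norm_sq UNIV (\<psi> \<omega>) = \<rho>) = \<omega>"
  proof (rule the_equality)
    show "\<omega> \<in> W \<and> L2_norm_sq UNIV (\<psi> \<omega>) = \<rho>" using assms(1,2) by simp
    show "\<omega>' = \<omega>" if "\<omega>' \<in> W \<and> L2_norm_sq UNIV (\<psi> \<omega>') = \<rho>" for \<omega>'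
      using that by (intro assms(3)) simp_all
  qed
  then show ?thesis by (simp only: member_of_mass_def)
qed

lemma phi_plus_frequency:
  assumes "lam > 0" "\<rho> > 0"
  obtains \<Omega> where "\<And>\<gamma>. \<gamma> > 0 \<Longrightarrow> \<Omega> \<gamma> > 0"
    "\<And>s \<gamma>. \<gamma> > 0 \<Longrightarrow> phi_plus s lam \<rho> \<gamma> = psi_plus s lam \<gamma> (\<Omega> \<gamma>)"
    "((\<lambda>\<gamma>. sqrt (\<Omega> \<gamma>)) \<longlongrightarrow> lam * \<rho> / 4) (at_right 0)"
proof -
  let ?m = "lam * \<rho> / 4"
  have "\<exists>\<omega>. \<gamma> > 0 \<longrightarrow> \<omega> > 0 \<and> mass_plus lam \<gamma> \<omega> = \<rho> \<and> ?m - \<gamma> * ?m\<^sup>2 / 4 \<le> sqrt \<omega> \<and> sqrt \<omega> \<le> ?m" for \<gamma>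
    using mass_plus_attains[OF assms(1) _ assms(2), of \<gamma>] by metis
  then obtain \<Omega> where W: "\<And>\<gamma>. \<gamma> > 0 \<Longrightarrow> \<Omega> \<gamma> > 0 \<and> mass_plus lam \<gamma> (\<Omega> \<gamma>) = \<rho> \<and>
      ?m - \<gamma> * ?m\<^sup>2 / 4 \<le> sqrt (\<Omega> \<gamma>) \<and> sqrt (\<Omega> \<gamma>) \<le> ?m"
    by metis
  show ?thesis
  proof (rule that[of \<Omega>])
    show "\<Omega> \<gamma> > 0" if "\<gamma> > 0" for \<gamma> using W[OF that] by simp
    show "phi_plus s lam \<rho> \<gamma> = psi_plus s lam \<gamma> (\<Omega> \<gamma>)" if "\<gamma> > 0" for s \<gamma>
      unfolding phi_plus_def
    proof (rule member_of_mass_eq)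
      fix \<omega> assume "\<omega> \<in> {0<..}" "L2_norm_sq UNIV (psi_plus s lam \<gamma> \<omega>) = \<rho>"
      then have "\<omega> > 0" "mass_plus lam \<gamma> \<omega> = mass_plus lam \<gamma> (\<Omega> \<gamma>)"
        using W[OF that] L2_norm_sq_psi_plus[OF assms(1) that] by auto
      then show "\<omega> = \<Omega> \<gamma>"
        using mass_plus_strict_mono[OF assms(1) that, of \<omega> "\<Omega> \<gamma>"]
          mass_plus_strict_mono[OF assms(1) that, of "\<Omega> \<gamma>" \<omega>] W[OF that]
        by (cases \<omega> "\<Omega> \<gamma>" rule: linorder_cases) auto
    qed (use W[OF that] L2_norm_sq_psi_plus[OF assms(1) that] in auto)
    show "((\<lambda>\<gamma>. sqrt (\<Omega> \<gamma>)) \<longlongrightarrow> ?m) (at_right 0)"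
    proof (rule tendsto_sandwich)
      show "((\<lambda>\<gamma>. ?m - \<gamma> * ?m\<^sup>2 / 4) \<longlongrightarrow> ?m) (at_right 0)"
        by (auto intro!: tendsto_eq_intros)
      show "\<forall>\<^sub>F \<gamma> in at_right 0. ?m - \<gamma> * ?m\<^sup>2 / 4 \<le> sqrt (\<Omega> \<gamma>)"
        "\<forall>\<^sub>F \<gamma> in at_right 0. sqrt (\<Omega> \<gamma>) \<le> ?m"
        using eventually_at_right_less[of "0::real"] by (eventually_elim; use W in blast)+
    qed simp
  qed
qed

text \<open>Both quantities are functions of \<open>u = \<gamma> \<surd>\<omega>\<close> alone, and \<open>u \<rightarrow> 0+\<close>. The term \<open>\<surd>(1 + u\<^sup>2) - 1\<close> is of second order
  in \<open>u\<close>, whereas the outer square root behaves like \<open>\<surd>2 u\<close>.\<close>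

lemma t_tendsto:
  assumes pos: "\<And>\<gamma>. \<gamma> > 0 \<Longrightarrow> \<Omega> \<gamma> > 0"
    and lim: "((\<lambda>\<gamma>. sqrt (\<Omega> \<gamma>)) \<longlongrightarrow> s0) (at_right 0)"
  shows "((\<lambda>\<gamma>. t1 \<gamma> (\<Omega> \<gamma>)) \<longlongrightarrow> sqrt 2 / 2) (at_right 0)"
    "((\<lambda>\<gamma>. t2 \<gamma> (\<Omega> \<gamma>)) \<longlongrightarrow> sqrt 2 / 2) (at_right 0)"
proof -
  define u where "u \<gamma> = \<gamma> * sqrt (\<Omega> \<gamma>)" for \<gamma>
  have "((\<lambda>\<gamma>. \<gamma> * sqrt (\<Omega> \<gamma>)) \<longlongrightarrow> 0 * s0) (at_right 0)"
    by (rule tendsto_mult[OF tendsto_ident_at lim])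
  then have "(u \<longlongrightarrow> 0) (at_right 0)" by (simp add: u_def [abs_def])
  moreover have "\<forall>\<^sub>F \<gamma> in at_right 0. u \<gamma> \<in> {0<..} \<and> u \<gamma> \<noteq> 0"
    using eventually_at_right_less[of "0::real"]
  proof eventually_elim
    case (elim \<gamma>)
    then have "u \<gamma> > 0" using pos by (simp add: u_def)
    then show ?case by simp
  qed
  ultimately have u: "filterlim u (at_right 0) (at_right 0)"
    by (simp add: filterlim_at)
  have u2: "(u \<gamma>)\<^sup>2 = \<gamma>\<^sup>2 * \<Omega> \<gamma>" if "\<gamma> > 0" for \<gamma>
    using pos[OF that] by (simp add: u_def power_mult_distrib)
  have t: "\<forall>\<^sub>F \<gamma> in at_right 0. (1 - sqrt (1 + (u \<gamma>)\<^sup>2) + sqrt ((u \<gamma>)\<^sup>2 - 2 + 2 * sqrt (1 + (u \<gamma>)\<^sup>2))) / (2 * u \<gamma>)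
      = t1 \<gamma> (\<Omega> \<gamma>)"
    "\<forall>\<^sub>F \<gamma> in at_right 0. (- 1 + sqrt (1 + (u \<gamma>)\<^sup>2) + sqrt ((u \<gamma>)\<^sup>2 - 2 + 2 * sqrt (1 + (u \<gamma>)\<^sup>2))) / (2 * u \<gamma>)
      = t2 \<gamma> (\<Omega> \<gamma>)"
    using eventually_at_right_less[of "0::real"]
    by (eventually_elim; simp only: t1_def t2_def u2; simp only: u_def mult.assoc)+
  have "((\<lambda>u::real. (1 - sqrt (1 + u\<^sup>2) + sqrt (u\<^sup>2 - 2 + 2 * sqrt (1 + u\<^sup>2))) / (2 * u)) \<longlongrightarrow> sqrt 2 / 2) (at_right 0)"
    by real_asymp (simp add: powr_half_sqrt)
  from filterlim_compose[OF this u] show "((\<lambda>\<gamma>. t1 \<gamma> (\<Omega> \<gamma>)) \<longlongrightarrow> sqrt 2 / 2) (at_right 0)"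
    by (rule Lim_transform_eventually) (rule t)
  have "((\<lambda>u::real. (- 1 + sqrt (1 + u\<^sup>2) + sqrt (u\<^sup>2 - 2 + 2 * sqrt (1 + u\<^sup>2))) / (2 * u)) \<longlongrightarrow> sqrt 2 / 2) (at_right 0)"
    by real_asymp (simp add: powr_half_sqrt)
  from filterlim_compose[OF this u] show "((\<lambda>\<gamma>. t2 \<gamma> (\<Omega> \<gamma>)) \<longlongrightarrow> sqrt 2 / 2) (at_right 0)"
    by (rule Lim_transform_eventually) (rule t)
qed

lemma artanh_half_sqrt_2: "artanh (sqrt 2 / 2) = ln (3 + 2 * sqrt 2) / 2"
proof -
  have "sqrt 2 < (2::real)" by (rule real_less_lsqrt) auto
  moreover have "1 + sqrt 2 / 2 = (3 + 2 * sqrt (2::real)) * (1 - sqrt 2 / 2)"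
    by (simp add: algebra_simps)
  ultimately have "(1 + sqrt 2 / 2) / (1 - sqrt 2 / 2) = 3 + 2 * sqrt (2::real)"
    by simp
  then show ?thesis by (simp add: artanh_def)
qed

lemma phi_plus_tendsto_Q:
  assumes "lam > 0" "\<rho> > 0"
  shows "tendsto_Q (\<lambda>\<gamma>. phi_plus s lam \<rho> \<gamma>)
    (soliton (sqrt (lam / 2) * (\<rho> / 2)) (lam * \<rho> / 4)
       ((case s of Plus \<Rightarrow> 1 | Minus \<Rightarrow> - 1) * (ln (3 + 2 * sqrt 2) / 2))) (at_right 0)"
proof -
  obtain \<Omega> where pos: "\<And>\<gamma>. \<gamma> > 0 \<Longrightarrow> \<Omega> \<gamma> > 0"
    and phi: "\<And>s \<gamma>. \<gamma> > 0 \<Longrightarrow> phi_plus s lam \<rho> \<gamma> = psi_plus s lam \<gamma> (\<Omega> \<gamma>)"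
    and lim: "((\<lambda>\<gamma>. sqrt (\<Omega> \<gamma>)) \<longlongrightarrow> lam * \<rho> / 4) (at_right 0)"
    by (rule phi_plus_frequency[OF assms]) (rule that)
  have "sqrt 2 < (2::real)" by (rule real_less_lsqrt) auto
  then have lt: "- 1 < sqrt 2 / (2::real)" "sqrt 2 / 2 < (1::real)"
    by (auto intro: less_le_trans[of _ 0])
  have at: "((\<lambda>\<gamma>. artanh (t1 \<gamma> (\<Omega> \<gamma>))) \<longlongrightarrow> ln (3 + 2 * sqrt 2) / 2) (at_right 0)"
    "((\<lambda>\<gamma>. artanh (t2 \<gamma> (\<Omega> \<gamma>))) \<longlongrightarrow> ln (3 + 2 * sqrt 2) / 2) (at_right 0)"
    unfolding artanh_half_sqrt_2 [symmetric]
    by (intro tendsto_artanh t_tendsto[OF pos lim] lt; simp)+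
  have A: "((\<lambda>\<gamma>. sqrt (2 * \<Omega> \<gamma> / lam)) \<longlongrightarrow> sqrt (lam / 2) * (\<rho> / 2)) (at_right 0)"
  proof -
    have "((\<lambda>\<gamma>. sqrt (2 / lam) * sqrt (\<Omega> \<gamma>)) \<longlongrightarrow> sqrt (2 / lam) * (lam * \<rho> / 4)) (at_right 0)"
      by (intro tendsto_intros lim)
    moreover have "sqrt (2 / lam) * (lam * \<rho> / 4) = sqrt (lam / 2) * (\<rho> / 2)"
    proof -
      have "sqrt (2 / lam) * (lam / 2) = sqrt (2 / lam * (lam / 2)\<^sup>2)"
        unfolding real_sqrt_mult real_sqrt_abs using assms by simp
      also have "2 / lam * (lam / 2)\<^sup>2 = lam / 2"
        using assms by (simp add: power2_eq_square)
      finally have "sqrt (2 / lam) * (lam / 2) * (\<rho> / 2) = sqrt (lam / 2) * (\<rho> / 2)"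
        by (simp only:)
      then show ?thesis by (simp add: mult_ac)
    qed
    moreover have "sqrt (2 / lam) * sqrt (\<Omega> \<gamma>) = sqrt (2 * \<Omega> \<gamma> / lam)" for \<gamma>
      by (simp flip: real_sqrt_mult)
    ultimately show ?thesis by (simp only:)
  qed
  have "tendsto_Q (\<lambda>\<gamma>. two_solitons (sqrt (2 * \<Omega> \<gamma> / lam)) (phase_left s \<gamma> (\<Omega> \<gamma>))
           (sqrt (2 * \<Omega> \<gamma> / lam)) (phase_right s \<gamma> (\<Omega> \<gamma>)) (sqrt (\<Omega> \<gamma>)))
      (soliton (sqrt (lam / 2) * (\<rho> / 2)) (lam * \<rho> / 4)
       ((case s of Plus \<Rightarrow> 1 | Minus \<Rightarrow> - 1) * (ln (3 + 2 * sqrt 2) / 2))) (at_right 0)"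
  proof (rule two_solitons_tendsto_Q[OF _ A lim])
    show "((\<lambda>\<gamma>. phase_left s \<gamma> (\<Omega> \<gamma>)) \<longlongrightarrow> (case s of Plus \<Rightarrow> 1 | Minus \<Rightarrow> - 1) * (ln (3 + 2 * sqrt 2) / 2)) (at_right 0)"
      "((\<lambda>\<gamma>. phase_right s \<gamma> (\<Omega> \<gamma>)) \<longlongrightarrow> (case s of Plus \<Rightarrow> 1 | Minus \<Rightarrow> - 1) * (ln (3 + 2 * sqrt 2) / 2)) (at_right 0)"
      using at tendsto_minus[OF at(1)] tendsto_minus[OF at(2)]
      by (cases s; simp add: phase_left_def phase_right_def)+
  qed (use assms in simp)
  moreover have "\<forall>\<^sub>F \<gamma> in at_right 0. two_solitons (sqrt (2 * \<Omega> \<gamma> / lam)) (phase_left s \<gamma> (\<Omega> \<gamma>))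
           (sqrt (2 * \<Omega> \<gamma> / lam)) (phase_right s \<gamma> (\<Omega> \<gamma>)) (sqrt (\<Omega> \<gamma>)) = phi_plus s lam \<rho> \<gamma>"
    using eventually_at_right_less[of "0::real"]
    by eventually_elim (simp add: phi pos psi_plus_eq_two_solitons)
  ultimately show ?thesis
    by (rule tendsto_Q_cong)
qed

section \<open>The antisymmetric family\<close>

text \<open>The condition on \<open>\<omega>\<close> says that \<open>2 / (\<gamma> \<surd>\<omega>) < 1\<close>, so that this number is the hyperbolic tangent of
  the phase.\<close>

lemma L2_norm_sq_psi_minus:
  assumes "lam > 0" "\<gamma> > 0" "\<omega> > 4 / \<gamma>\<^sup>2"
  shows "L2_norm_sq UNIV (psi_minus lam \<gamma> \<omega>) = 4 / lam * (sqrt \<omega> - 2 / \<gamma>)"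
proof -
  define r where "r = sqrt \<omega>"
  have "0 \<le> 4 / \<gamma>\<^sup>2" by simp
  then have "\<omega> > 0" using assms(3) by linarith
  then have r: "r > 0" "\<omega> = r\<^sup>2" by (simp_all add: r_def)
  have "sqrt (4 / \<gamma>\<^sup>2) < sqrt \<omega>" using assms(3) by simp
  then have "2 < \<gamma> * r"
    using assms(2) by (simp add: real_sqrt_divide field_simps r_def)
  then have "\<bar>2 / (\<gamma> * r)\<bar> < 1" by simp
  then have t: "tanh (artanh (2 / (\<gamma> * r))) = 2 / (\<gamma> * r)" "tanh (- artanh (2 / (\<gamma> * r))) = - (2 / (\<gamma> * r))"
    by (simp_all only: tanh_minus tanh_artanh_real)
  have q: "(sqrt (2 * \<omega> / lam))\<^sup>2 = 2 * r\<^sup>2 / lam" "(- sqrt (2 * \<omega> / lam))\<^sup>2 = 2 * r\<^sup>2 / lam"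
    using assms(1) \<open>\<omega> > 0\<close> by (simp_all add: r(2))
  have "L2_norm_sq UNIV (psi_minus lam \<gamma> \<omega>) =
      (2 * r\<^sup>2 / lam * (1 - 2 / (\<gamma> * r)) + 2 * r\<^sup>2 / lam * (1 + - (2 / (\<gamma> * r)))) / r"
    using r(1) unfolding psi_minus_eq_two_solitons[OF assms(2) \<open>\<omega> > 0\<close>] r_def [symmetric]
    by (simp only: L2_norm_sq_two_solitons t q)
  also have "\<dots> = 4 / lam * (r - 2 / \<gamma>)"
    using r(1) assms(1,2) by (simp add: field_simps power2_eq_square)
  finally show ?thesis by (simp add: r_def)
qed

text \<open>The mass is affine in \<open>\<surd>\<omega>\<close>, hence the frequency of given mass is explicit.\<close>

lemma phi_minus_eq:
  assumes "lam > 0" "\<rho> > 0" "\<gamma> > 0"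
  shows "phi_minus lam \<rho> \<gamma> = psi_minus lam \<gamma> ((2 / \<gamma> + lam * \<rho> / 4)\<^sup>2)"
proof -
  let ?r = "2 / \<gamma> + lam * \<rho> / 4"
  have "2 / \<gamma> > 0" "lam * \<rho> / 4 > 0" using assms by simp_all
  then have r: "2 / \<gamma> < ?r" "?r > 0" by linarith+
  have "(2 / \<gamma>)\<^sup>2 < ?r\<^sup>2"
    using r \<open>2 / \<gamma> > 0\<close> by (intro power_strict_mono) auto
  then have w: "?r\<^sup>2 > 4 / \<gamma>\<^sup>2" by (simp add: power_divide)
  have s: "sqrt (?r\<^sup>2) = ?r" using r(2) by simp
  show "phi_minus lam \<rho> \<gamma> = psi_minus lam \<gamma> (?r\<^sup>2)"
    unfolding phi_minus_def
  proof (rule member_of_mass_eq)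
    show "?r\<^sup>2 \<in> {4 / \<gamma>\<^sup>2<..}" using w by simp
    show "L2_norm_sq UNIV (psi_minus lam \<gamma> (?r\<^sup>2)) = \<rho>"
      unfolding L2_norm_sq_psi_minus[OF assms(1,3) w] s using assms(1) by simp
    fix \<omega> assume w': "\<omega> \<in> {4 / \<gamma>\<^sup>2<..}" "L2_norm_sq UNIV (psi_minus lam \<gamma> \<omega>) = \<rho>"
    then have "4 / lam * (sqrt \<omega> - 2 / \<gamma>) = \<rho>"
      using L2_norm_sq_psi_minus[OF assms(1,3)] by simp
    then have "sqrt \<omega> = ?r" using assms(1) by (simp add: field_simps)
    moreover have "\<omega> \<ge> 0"
    proof -
      have "0 \<le> 4 / \<gamma>\<^sup>2" by simp
      also have "\<dots> < \<omega>" using w'(1) by simp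
      finally show ?thesis by simp
    qed
    ultimately show "\<omega> = ?r\<^sup>2" using real_sqrt_pow2[of \<omega>] by simp
  qed
qed

text \<open>The factor \<open>exp (-h)\<close> measures how far into the tail of the soliton the origin lies. The remaining
  factor \<open>exp (-s \<bar>x\<bar>)\<close> is estimated by \<open>sech\<^sup>2 (s x / 2)\<close>, whose integral is known.\<close>

lemma antisymmetric_solitons_bound:
  assumes "s > 0" "h \<ge> 0" "B \<ge> 0"
  shows "cmod (two_solitons (- B) h B (- h) s x) \<le> 2 * B * exp (- h) * (sech (s / 2 * x))\<^sup>2"
proof -
  have "cmod (two_solitons (- B) h B (- h) s x) \<le> B * sech (s * \<bar>x\<bar> + h)"
  proof -
    have *: "cmod (complex_of_real (B * sech y)) = B * sech y" for y
      using sech_pos[of y] assms(3) by (simp only: norm_of_real abs_of_nonneg mult_nonneg_nonneg less_imp_le)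
    have **: "cmod (complex_of_real (- B * sech y)) = B * sech y" for y
      using *[of y] by simp
    consider "x < 0" | "x = 0" | "x > 0" by linarith
    then show ?thesis
    proof cases
      case 1
      then have "s * x - h = - (s * \<bar>x\<bar> + h)" by simp
      then have "sech (s * x - h) = sech (s * \<bar>x\<bar> + h)" by (simp only: sech_minus)
      then show ?thesis
        using 1 ** by (simp only: two_solitons_def soliton_def if_True order_refl)
    next
      case 2
      then show ?thesis using assms(3) sech_pos[of h] by (simp add: two_solitons_def)
    next
      case 3
      then have "s * x - - h = s * \<bar>x\<bar> + h" "\<not> x < 0" by simp_all
      then show ?thesis
        using 3 * by (simp only: two_solitons_def soliton_def if_True if_False order_refl)
    qed
  qed
  also have "\<dots> \<le> B * (2 * exp (- (s * \<bar>x\<bar> + h)))"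
    using sech_le_exp[of "s * \<bar>x\<bar> + h"] assms by (intro mult_left_mono) auto
  also have "exp (- (s * \<bar>x\<bar> + h)) = exp (- h) * (exp (- \<bar>s / 2 * x\<bar>))\<^sup>2"
    using assms(1) by (simp add: abs_mult power2_eq_square flip: exp_add)
  also have "B * (2 * (exp (- h) * (exp (- \<bar>s / 2 * x\<bar>))\<^sup>2)) \<le> B * (2 * (exp (- h) * (sech (s / 2 * x))\<^sup>2))"
    using assms(3) by (intro mult_left_mono power_mono exp_le_sech) auto
  finally show ?thesis by (simp add: mult_ac)
qed

lemma two_solitons_measurable: "two_solitons A a B b s \<in> borel_measurable lebesgue"
proof -
  have "two_solitons A a B b s =
      (\<lambda>x. indicat_real {..<0} x *\<^sub>R soliton A s a x + indicat_real {0<..} x *\<^sub>R soliton B s b x)"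
    by (simp add: fun_eq_iff two_solitons_def)
  moreover have "\<dots> \<in> borel_measurable lebesgue"
    by (intro borel_measurable_add borel_measurable_scaleR borel_measurable_indicator
        continuous_imp_lebesgue_measurable continuous_soliton) auto
  ultimately show ?thesis by simp
qed

lemma locally_integrableI:
  assumes "integrable lebesgue f"
  shows "locally_integrable f"
  unfolding locally_integrable_def
proof (intro allI impI)
  fix K :: "real set" assume "compact K"
  then have "K \<in> sets lebesgue" by (simp add: borel_compact)
  then show "integrable (lebesgue_on K) f"
    using integrable_mult_indicator[OF _ assms, of K] by (simp add: integrable_restrict_space)
qed

text \<open>With \<open>B\<close> proportional to \<open>s\<close>, as for the stationary states, the bound depends on the phase \<open>h\<close> only,
  however large the frequency.\<close>

lemma antisymmetric_solitons_integrable: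
  assumes "s > 0" "h \<ge> 0" "B \<ge> 0"
  shows "integrable lebesgue (two_solitons (- B) h B (- h) s)"
    "(\<integral>x. cmod (two_solitons (- B) h B (- h) s x) \<partial>lebesgue) \<le> 8 * (B / s) * exp (- h)"
proof -
  let ?g = "\<lambda>x. 2 * B * exp (- h) * (sech (s / 2 * x))\<^sup>2"
  have "s / 2 > 0" using assms by simp
  note sech = integrable_sech_sq[OF this, of 0, unfolded diff_zero]
  have g: "integrable lebesgue ?g" by (intro Bochner_Integration.integrable_mult_right sech)
  note bound = antisymmetric_solitons_bound[OF assms]
  show f: "integrable lebesgue (two_solitons (- B) h B (- h) s)"
  proof (rule Bochner_Integration.integrable_bound[OF g two_solitons_measurable])
    show "AE x in lebesgue. cmod (two_solitons (- B) h B (- h) s x) \<le> norm (?g x)"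
      using bound by (intro AE_I2) (metis abs_ge_self order_trans real_norm_def)
  qed
  have "(\<integral>x. cmod (two_solitons (- B) h B (- h) s x) \<partial>lebesgue) \<le> (\<integral>x. ?g x \<partial>lebesgue)"
    by (rule integral_mono[OF integrable_norm[OF f] g bound])
  also have "\<dots> = 2 * B * exp (- h) * (2 / (s / 2))"
    by (simp only: integral_mult_right_zero sech(2))
  finally show "(\<integral>x. cmod (two_solitons (- B) h B (- h) s x) \<partial>lebesgue) \<le> 8 * (B / s) * exp (- h)"
    by (simp add: mult_ac)
qed

lemma test_function_bounded:
  assumes "test_function S \<phi>"
  obtains C where "\<And>x. cmod (\<phi> x) \<le> C" "continuous_on UNIV \<phi>"
proof -
  obtain \<phi>' M where \<phi>: "\<And>x. (\<phi> has_vector_derivative \<phi>' x) (at x)"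
    "continuous_on UNIV \<phi>" "continuous_on UNIV \<phi>'"
    "\<And>x. x \<notin> {-M..M} \<inter> S \<Longrightarrow> \<phi> x = 0" "\<And>x. x \<notin> {-M..M} \<inter> S \<Longrightarrow> \<phi>' x = 0"
    by (rule test_functionE[OF assms]) (rule that)
  have K: "compact (\<phi> ` {-M..M})"
    by (rule compact_continuous_image[OF continuous_on_subset[OF \<phi>(2)]]) auto
  obtain C where C: "\<And>y. y \<in> \<phi> ` {-M..M} \<Longrightarrow> cmod y \<le> C"
    using compact_imp_bounded[OF K] unfolding bounded_iff by auto
  have "cmod (\<phi> x) \<le> max C 0" for x
  proof (cases "x \<in> {-M..M}")
    case True
    then have "cmod (\<phi> x) \<le> C" by (intro C imageI)
    then show ?thesis by simp
  next
    case False
    then have "\<phi> x = 0" by (intro \<phi>(4)) blast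
    then show ?thesis by simp
  qed
  then show ?thesis by (rule that[OF _ \<phi>(2)])
qed

text \<open>Test functions are bounded.\<close>

lemma tendsto_distribution_zero_if_L1:
  assumes int: "\<forall>\<^sub>F t in F. integrable lebesgue (f t)"
    and lim: "((\<lambda>t. \<integral>x. cmod (f t x) \<partial>lebesgue) \<longlongrightarrow> 0) F"
  shows "tendsto_distribution f (\<lambda>_. 0) F"
  unfolding tendsto_distribution_def
proof (intro conjI allI impI)
  show "locally_integrable (\<lambda>_. 0)" by (simp add: locally_integrable_def)
  show "\<forall>\<^sub>F t in F. locally_integrable (f t)"
    using int by eventually_elim (rule locally_integrableI)
  fix \<phi> assume "test_function UNIV \<phi>"
  then obtain C where C: "\<And>x. cmod (\<phi> x) \<le> C" and c: "continuous_on UNIV \<phi>"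
    by (rule test_function_bounded) (rule that)
  have "\<forall>\<^sub>F t in F. norm (\<integral>x. f t x * \<phi> x \<partial>lebesgue) \<le> C * (\<integral>x. cmod (f t x) \<partial>lebesgue)"
    using int
  proof eventually_elim
    case (elim t)
    have b: "cmod (f t x * \<phi> x) \<le> C * cmod (f t x)" for x
      using mult_right_mono[OF C[of x] norm_ge_zero[of "f t x"]] by (simp add: norm_mult mult.commute)
    have g: "integrable lebesgue (\<lambda>x. C * cmod (f t x))"
      using elim by (intro Bochner_Integration.integrable_mult_right integrable_norm)
    have i: "integrable lebesgue (\<lambda>x. f t x * \<phi> x)"
    proof (rule Bochner_Integration.integrable_bound[OF g])
      show "(\<lambda>x. f t x * \<phi> x) \<in> borel_measurable lebesgue"
        by (intro borel_measurable_times borel_measurable_integrable[OF elim] continuous_imp_lebesgue_measurable c)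
      show "AE x in lebesgue. cmod (f t x * \<phi> x) \<le> norm (C * cmod (f t x))"
        using b by (intro AE_I2) (metis abs_ge_self order_trans real_norm_def)
    qed
    have "norm (\<integral>x. f t x * \<phi> x \<partial>lebesgue) \<le> (\<integral>x. cmod (f t x * \<phi> x) \<partial>lebesgue)"
      by (rule integral_norm_bound)
    also have "\<dots> \<le> (\<integral>x. C * cmod (f t x) \<partial>lebesgue)"
      by (rule integral_mono[OF integrable_norm[OF i] g b])
    finally show ?case by simp
  qed
  moreover have "((\<lambda>t. C * (\<integral>x. cmod (f t x) \<partial>lebesgue)) \<longlongrightarrow> 0) F"
    using tendsto_mult[OF tendsto_const lim, of C] by simp
  ultimately have "((\<lambda>t. \<integral>x. f t x * \<phi> x \<partial>lebesgue) \<longlongrightarrow> 0) F"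
    by (rule Lim_null_comparison)
  then show "((\<lambda>t. \<integral>x. f t x * \<phi> x \<partial>lebesgue) \<longlongrightarrow> (\<integral>x. 0 * \<phi> x \<partial>lebesgue)) F"
    by simp
qed

text \<open>Here \<open>\<gamma> \<surd>\<omega> = 2 + \<gamma> \<lambda>\<rho>/4\<close>, so the hyperbolic tangent of the phase tends to \<open>1\<close> and the phase to
  infinity.\<close>

lemma phi_minus_tendsto_distribution:
  assumes "lam > 0" "\<rho> > 0"
  shows "tendsto_distribution (\<lambda>\<gamma>. phi_minus lam \<rho> \<gamma>) (\<lambda>_. 0) (at_right 0)"
proof (rule tendsto_distribution_zero_if_L1)
  define m where "m = lam * \<rho> / 4"
  define t where "t \<gamma> = 2 / (2 + m * \<gamma>)" for \<gamma>
  have m: "m > 0" using assms by (simp add: m_def)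
  have t: "0 < t \<gamma>" "t \<gamma> < 1" if "\<gamma> > 0" for \<gamma>
  proof -
    have "m * \<gamma> > 0" using m that by simp
    then show "0 < t \<gamma>" "t \<gamma> < 1" by (simp_all add: t_def)
  qed
  have h: "artanh (t \<gamma>) \<ge> 0" if "\<gamma> > 0" for \<gamma>
  proof -
    have "1 \<le> (1 + t \<gamma>) / (1 - t \<gamma>)" using t[OF that] by (simp add: pos_le_divide_eq)
    then show ?thesis by (simp add: artanh_def)
  qed
  have key: "integrable lebesgue (phi_minus lam \<rho> \<gamma>) \<and>
      (\<integral>x. cmod (phi_minus lam \<rho> \<gamma> x) \<partial>lebesgue) \<le> 8 * sqrt (2 / lam) * exp (- artanh (t \<gamma>))"
    if "\<gamma> > 0" for \<gamma>
  proof -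
    define r where "r = 2 / \<gamma> + lam * \<rho> / 4"
    have "2 / \<gamma> > 0" using that by simp
    then have r: "r > 0" using m unfolding r_def m_def by linarith
    have sqrt_r: "sqrt (r\<^sup>2) = r" using r by simp
    have "\<gamma> * r = 2 + m * \<gamma>"
      using that by (simp add: r_def m_def field_simps)
    then have eq: "phi_minus lam \<rho> \<gamma> = two_solitons (- sqrt (2 * r\<^sup>2 / lam)) (artanh (t \<gamma>))
        (sqrt (2 * r\<^sup>2 / lam)) (- artanh (t \<gamma>)) r"
      using phi_minus_eq[OF assms that] psi_minus_eq_two_solitons[OF that zero_less_power[OF r], of lam 2] sqrt_r
      by (simp add: t_def flip: r_def)
    have "sqrt (2 * r\<^sup>2 / lam) = sqrt (2 / lam) * r"
      using r by (simp add: real_sqrt_mult real_sqrt_divide)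
    then have B: "sqrt (2 * r\<^sup>2 / lam) / r = sqrt (2 / lam)"
      using r by simp
    have "sqrt (2 * r\<^sup>2 / lam) \<ge> 0" using assms by simp
    from antisymmetric_solitons_integrable[OF r h[OF that] this] show ?thesis
      unfolding eq B by blast
  qed
  show "\<forall>\<^sub>F \<gamma> in at_right 0. integrable lebesgue (phi_minus lam \<rho> \<gamma>)"
    using eventually_at_right_less[of "0::real"] by eventually_elim (simp add: key)
  have "(t \<longlongrightarrow> 1) (at_right 0)"
    unfolding t_def by real_asymp
  moreover have "\<forall>\<^sub>F \<gamma> in at_right 0. t \<gamma> \<in> {..<1} \<and> t \<gamma> \<noteq> 1"
    using eventually_at_right_less[of "0::real"]
  proof eventually_elim
    case (elim \<gamma>)
    then show ?case using t(2)[of \<gamma>] by simp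
  qed
  ultimately have "filterlim t (at_left 1) (at_right 0)"
    by (simp add: filterlim_at)
  then have "filterlim (\<lambda>\<gamma>. artanh (t \<gamma>)) at_top (at_right 0)"
    by (rule filterlim_compose[OF artanh_real_at_left_1])
  then have "((\<lambda>\<gamma>. exp (- artanh (t \<gamma>))) \<longlongrightarrow> 0) (at_right 0)"
    by (intro filterlim_compose[OF exp_at_bot]) (simp add: filterlim_uminus_at_top)
  then have lim: "((\<lambda>\<gamma>. 8 * sqrt (2 / lam) * exp (- artanh (t \<gamma>))) \<longlongrightarrow> 0) (at_right 0)"
    using tendsto_mult[OF tendsto_const, of _ 0] by fastforce
  show "((\<lambda>\<gamma>. \<integral>x. cmod (phi_minus lam \<rho> \<gamma> x) \<partial>lebesgue) \<longlongrightarrow> 0) (at_right 0)"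
  proof (rule tendsto_sandwich[OF _ _ tendsto_const lim])
    show "\<forall>\<^sub>F \<gamma> in at_right 0. 0 \<le> (\<integral>x. cmod (phi_minus lam \<rho> \<gamma> x) \<partial>lebesgue)"
      by (intro always_eventually allI integral_nonneg_AE) simp
    show "\<forall>\<^sub>F \<gamma> in at_right 0. (\<integral>x. cmod (phi_minus lam \<rho> \<gamma> x) \<partial>lebesgue) \<le> 8 * sqrt (2 / lam) * exp (- artanh (t \<gamma>))"
      using eventually_at_right_less[of "0::real"] by eventually_elim (simp add: key)
  qed
qed

theorem theorem3p13:
  fixes lam \<rho> :: real
  assumes "lam > 0" and "\<rho> > 0"
  shows "tendsto_Q (\<lambda>\<gamma>. phi_plus Plus lam \<rho> \<gamma>)
           (\<lambda>x. complex_of_real (sqrt (lam / 2) * (\<rho> / 2) *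
              sech (lam * \<rho> / 4 * (x - 2 / (lam * \<rho>) * ln (3 + 2 * sqrt 2)))))
           (at_right 0)
       \<and> tendsto_Q (\<lambda>\<gamma>. phi_plus Minus lam \<rho> \<gamma>)
           (\<lambda>x. complex_of_real (sqrt (lam / 2) * (\<rho> / 2) *
              sech (lam * \<rho> / 4 * (x + 2 / (lam * \<rho>) * ln (3 + 2 * sqrt 2)))))
           (at_right 0)
       \<and> tendsto_distribution (\<lambda>\<gamma>. phi_minus lam \<rho> \<gamma>) (\<lambda>_. 0) (at_right 0)"
proof (intro conjI)
  let ?L = "ln (3 + 2 * sqrt 2) :: real"
  have shift: "lam * \<rho> / 4 * (2 / (lam * \<rho>) * ?L) = ?L / 2"
    using assms by simp
  have "soliton (sqrt (lam / 2) * (\<rho> / 2)) (lam * \<rho> / 4) (?L / 2) =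
      (\<lambda>x. complex_of_real (sqrt (lam / 2) * (\<rho> / 2) *
              sech (lam * \<rho> / 4 * (x - 2 / (lam * \<rho>) * ?L))))"
    unfolding soliton_def right_diff_distrib shift ..
  with phi_plus_tendsto_Q[OF assms, of Plus]
  show "tendsto_Q (\<lambda>\<gamma>. phi_plus Plus lam \<rho> \<gamma>)
           (\<lambda>x. complex_of_real (sqrt (lam / 2) * (\<rho> / 2) *
              sech (lam * \<rho> / 4 * (x - 2 / (lam * \<rho>) * ?L)))) (at_right 0)"
    by simp
  have "soliton (sqrt (lam / 2) * (\<rho> / 2)) (lam * \<rho> / 4) (- (?L / 2)) =
      (\<lambda>x. complex_of_real (sqrt (lam / 2) * (\<rho> / 2) *
              sech (lam * \<rho> / 4 * (x + 2 / (lam * \<rho>) * ?L))))"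
    unfolding soliton_def distrib_left shift diff_minus_eq_add ..
  with phi_plus_tendsto_Q[OF assms, of Minus]
  show "tendsto_Q (\<lambda>\<gamma>. phi_plus Minus lam \<rho> \<gamma>)
           (\<lambda>x. complex_of_real (sqrt (lam / 2) * (\<rho> / 2) *
              sech (lam * \<rho> / 4 * (x + 2 / (lam * \<rho>) * ?L)))) (at_right 0)"
    by simp
  show "tendsto_distribution (\<lambda>\<gamma>. phi_minus lam \<rho> \<gamma>) (\<lambda>_. 0) (at_right 0)"
    by (rule phi_minus_tendsto_distribution[OF assms])
qed

end
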